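(* Let $\lambda\ge 0$, $0\le\alpha<1$, $0\le k<\infty$, $u\in\mathbb{N}=\{1,2,3,\dots\}$, $v\in\mathbb{N}_0=\mathbb{N}\cup\{0\}$ with $u>v$. For $n\ge1$ let $$\xi_n=[1+(n-1)\lambda]^v+\frac{\left\{[1+(n-1)\lambda]^u-[1+(n-1)\lambda]^v\right\}(1+k)}{1-\alpha},$$ $$\eta_n=(-1)^{v-u}[1+(n-1)\lambda]^v+\frac{\left\{[1+(n-1)\lambda]^u-(-1)^{v-u}[1+(n-1)\lambda]^v\right\}(1+k)}{1-\alpha}.$$ Let $f_u=h+\overline{g_u}\in SH$ with $$h(z)=z-\sum_{n=2}^\infty|a_n|z^n,\qquad g_u(z)=(-1)^{u-1}\sum_{n=1}^\infty|b_n|z^n,\qquad |b_1|<1.$$ Then $f_u\in k\text{-}UTH(u,v,\alpha,\lambda)$ if and only if $$f_u(z)=\sum_{n=1}^\infty\left[x_nP_n(z)+y_nQ_n(z)\right],$$ where $P_1(z)=z$, $P_n(z)=z-\frac{1}{\xi_n}z^n$ for $n=2,3,\dots$, $Q_n(z)=z+(-1)^{u-1}\frac{1}{\eta_n}\overline{z}^n$ for $n=1,2,3,\dots$, and $x_n\ge0$, $y_n\ge0$ for all $n \geq 1$, $x_1=1-\sum_{n=2}^\infty x_n-\sum_{n=1}^\infty y_n$. In particular, the extreme points of $k\text{-}UTH(u,v,\alpha,\lambda)$ are $\{P_n\}$ and $\{Q_n\}$.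
   Context: $U=\{z\in\mathbb{C}:|z|<1\}$. $SH$ is the class of functions $f=h+\overline{g}$ ($h,g$ analytic in $U$) that are harmonic, univalent and sense-preserving in $U$ with $f(0)=0$, $f_z(0)=1$; $h$ and $g$ are written $h(z)=z+\sum_{n\ge2}a_nz^n$, $g(z)=\sum_{n\ge1}b_nz^n$, $|b_1|<1$. Al-Oboudi operator: for $\lambda\ge0$ and $u\in\mathbb{N}_0$, $D^uh(z)=z+\sum_{n=2}^\infty[1+(n-1)\lambda]^ua_nz^n$, $D^ug(z)=\sum_{n=1}^\infty[1+(n-1)\lambda]^ub_nz^n$, and $D^uf(z)=D^uh(z)+(-1)^u\overline{D^ug(z)}$. For $0\le\alpha<1$, $0\le k<\infty$, $u\in\mathbb{N}$, $v\in\mathbb{N}_0$, $u>v$, $\lambda\ge0$, the class $k\text{-}USH(u,v,\alpha,\lambda)$ consists of the functions $f=h+\overline{g}\in SH$ satisfying $$\operatorname{Re}\left\{(1+ke^{i\phi})\frac{D^uf(z)}{D^vf(z)}-ke^{i\phi}\right\}\ge\alpha$$ for all $z\in U\setminus\{0\}$ and all real $\phi$. The subclass $k\text{-}UTH(u,v,\alpha,\lambda)$ of $k\text{-}USH(u,v,\alpha,\lambda)$ consists of those members of the form $f_u=h+\overline{g_u}$ with $h(z)=z-\sum_{n\ge2}|a_n|z^n$, $g_u(z)=(-1)^{u-1}\sum_{n\ge1}|b_n|z^n$, $|b_1|<1$.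
   Formalization: The last sentence is false as stated: Q_1 is not univalent for even u−v, nor is P_2 for λ=0. Proved instead: all P_n, Q_n in SH are extreme points, and these are the only ones if λ≥1 or if P_n, Q_n lie in SH for all n≥2; the set of all the series has extreme points {P_n}, {Q_n}. *)

theory Defs
  imports "HOL-Complex_Analysis.Complex_Analysis" "HOL-Library.FuncSet"
begin

text \<open>
  Functions on the unit disc \<open>unit_disc\<close> are elements of \<open>extensional unit_disc\<close>, so that equality of
  functions is equality on \<open>unit_disc\<close>.
\<close>

abbreviation unit_disc :: "complex set" where
  "unit_disc \<equiv> ball 0 1"

text \<open>The normalisation \<open>g 0 = 0\<close> makes the decomposition \<open>f = h + cnj g\<close> unique on \<open>unit_disc\<close>.\<close>

definition harmonic_parts ::
    "(complex \<Rightarrow> complex) \<Rightarrow> (complex \<Rightarrow> complex) \<Rightarrow> (complex \<Rightarrow> complex) \<Rightarrow> bool" where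
  "harmonic_parts f h g \<longleftrightarrow>
     f \<in> extensional unit_disc \<and> h holomorphic_on unit_disc \<and> g holomorphic_on unit_disc \<and> g 0 = 0 \<and>
     (\<forall>z\<in>unit_disc. f z = h z + cnj (g z))"

text \<open>
  Here \<open>f\<^sub>z = h'\<close>, and the Jacobian of \<open>f\<close> is \<open>\<bar>h'\<bar>\<^sup>2 - \<bar>g'\<bar>\<^sup>2\<close>; sense-preserving means that it
  is positive. At the origin this gives \<open>\<bar>b\<^sub>1\<bar> < 1\<close>.
\<close>

definition SH :: "(complex \<Rightarrow> complex) set" where
  "SH = {f. \<exists>h g. harmonic_parts f h g \<and> inj_on f unit_disc \<and>
              (\<forall>z\<in>unit_disc. cmod (deriv g z) < cmod (deriv h z)) \<and>
              f 0 = 0 \<and> deriv h 0 = 1}"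

text \<open>
  The series is indexed from 0, so the summand with index \<open>n\<close> is the \<open>z ^ (n + 1)\<close> term,
  whose multiplier is \<open>(1 + n * lam) ^ u\<close>.
\<close>

definition al_oboudi :: "real \<Rightarrow> nat \<Rightarrow> (complex \<Rightarrow> complex) \<Rightarrow> complex \<Rightarrow> complex" where
  "al_oboudi lam u h z =
     (\<Sum>n. of_real ((1 + real n * lam) ^ u) * fps_nth (fps_expansion h 0) (Suc n) * z ^ Suc n)"

definition al_oboudi_harm ::
    "real \<Rightarrow> nat \<Rightarrow> (complex \<Rightarrow> complex) \<Rightarrow> (complex \<Rightarrow> complex) \<Rightarrow> complex \<Rightarrow> complex" where
  "al_oboudi_harm lam u h g z =
     al_oboudi lam u h z + (-1) ^ u * cnj (al_oboudi lam u g z)"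

text \<open>
  The requirement that the denominator be nonzero is implicit in the quotient; it has to be
  explicit because division by zero is total in HOL.
\<close>

definition USH :: "real \<Rightarrow> nat \<Rightarrow> nat \<Rightarrow> real \<Rightarrow> real \<Rightarrow> (complex \<Rightarrow> complex) set" where
  "USH k u v \<alpha> lam = {f \<in> SH. \<exists>h g. harmonic_parts f h g \<and>
     (\<forall>z\<in>unit_disc - {0}. \<forall>\<phi>::real.
        al_oboudi_harm lam v h g z \<noteq> 0 \<and>
        Re ((1 + of_real k * exp (\<i> * of_real \<phi>)) *
              (al_oboudi_harm lam u h g z / al_oboudi_harm lam v h g z)
            - of_real k * exp (\<i> * of_real \<phi>)) \<ge> \<alpha>)}"

definition neg_coeff_form ::
    "nat \<Rightarrow> (complex \<Rightarrow> complex) \<Rightarrow> (complex \<Rightarrow> complex) \<Rightarrow> (nat \<Rightarrow> complex) \<Rightarrow> (nat \<Rightarrow> complex) \<Rightarrow> bool"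
where
  "neg_coeff_form u h g a b \<longleftrightarrow>
     cmod (b 1) < 1 \<and>
     (\<forall>z\<in>unit_disc. summable (\<lambda>n. of_real (cmod (a (n + 2))) * z ^ (n + 2)) \<and>
            summable (\<lambda>n. of_real (cmod (b (n + 1))) * z ^ (n + 1)) \<and>
            h z = z - (\<Sum>n. of_real (cmod (a (n + 2))) * z ^ (n + 2)) \<and>
            g z = (-1) ^ (u - 1) * (\<Sum>n. of_real (cmod (b (n + 1))) * z ^ (n + 1)))"

definition UTH :: "real \<Rightarrow> nat \<Rightarrow> nat \<Rightarrow> real \<Rightarrow> real \<Rightarrow> (complex \<Rightarrow> complex) set" where
  "UTH k u v \<alpha> lam = {f \<in> USH k u v \<alpha> lam.
     \<exists>h g a b. harmonic_parts f h g \<and> neg_coeff_form u h g a b}"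

definition xi :: "real \<Rightarrow> nat \<Rightarrow> nat \<Rightarrow> real \<Rightarrow> real \<Rightarrow> nat \<Rightarrow> real" where
  "xi k u v \<alpha> lam n =
     (1 + (real n - 1) * lam) ^ v +
     ((1 + (real n - 1) * lam) ^ u - (1 + (real n - 1) * lam) ^ v) * (1 + k) / (1 - \<alpha>)"

definition eta :: "real \<Rightarrow> nat \<Rightarrow> nat \<Rightarrow> real \<Rightarrow> real \<Rightarrow> nat \<Rightarrow> real" where
  "eta k u v \<alpha> lam n =
     (-1) powi (int v - int u) * (1 + (real n - 1) * lam) ^ v +
     ((1 + (real n - 1) * lam) ^ u
        - (-1) powi (int v - int u) * (1 + (real n - 1) * lam) ^ v) * (1 + k) / (1 - \<alpha>)"

definition P_fun :: "real \<Rightarrow> nat \<Rightarrow> nat \<Rightarrow> real \<Rightarrow> real \<Rightarrow> nat \<Rightarrow> complex \<Rightarrow> complex" where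
  "P_fun k u v \<alpha> lam n = (\<lambda>z\<in>unit_disc.
     if n = 1 then z else z - of_real (1 / xi k u v \<alpha> lam n) * z ^ n)"

definition Q_fun :: "real \<Rightarrow> nat \<Rightarrow> nat \<Rightarrow> real \<Rightarrow> real \<Rightarrow> nat \<Rightarrow> complex \<Rightarrow> complex" where
  "Q_fun k u v \<alpha> lam n = (\<lambda>z\<in>unit_disc.
     z + (-1) ^ (u - 1) * of_real (1 / eta k u v \<alpha> lam n) * cnj z ^ n)"

text \<open>The values \<open>x 0\<close> and \<open>y 0\<close> are irrelevant; all sums over \<open>n \<ge> 1\<close> or \<open>n \<ge> 2\<close> are shifted.\<close>

definition PQ_series :: "real \<Rightarrow> nat \<Rightarrow> nat \<Rightarrow> real \<Rightarrow> real \<Rightarrow> (complex \<Rightarrow> complex) set" where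
  "PQ_series k u v \<alpha> lam = {f \<in> extensional unit_disc. \<exists>x y :: nat \<Rightarrow> real.
     (\<forall>n\<ge>1. 0 \<le> x n \<and> 0 \<le> y n) \<and>
     summable (\<lambda>n. x (n + 2)) \<and> summable (\<lambda>n. y (n + 1)) \<and>
     x 1 = 1 - (\<Sum>n. x (n + 2)) - (\<Sum>n. y (n + 1)) \<and>
     (\<forall>z\<in>unit_disc. (\<lambda>n. of_real (x (n + 1)) * P_fun k u v \<alpha> lam (n + 1) z
                   + of_real (y (n + 1)) * Q_fun k u v \<alpha> lam (n + 1) z) sums f z)}"

definition PQ :: "real \<Rightarrow> nat \<Rightarrow> nat \<Rightarrow> real \<Rightarrow> real \<Rightarrow> (complex \<Rightarrow> complex) set" where
  "PQ k u v \<alpha> lam = P_fun k u v \<alpha> lam ` {1..} \<union> Q_fun k u v \<alpha> lam ` {1..}"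

text \<open>
  This is what \<^term>\<open>(extreme_point_of)\<close> unfolds to, for functions on \<open>unit_disc\<close>; the library constant
  needs a real vector space type.
\<close>

definition extreme_points :: "(complex \<Rightarrow> complex) set \<Rightarrow> (complex \<Rightarrow> complex) set" where
  "extreme_points S = {f \<in> S. \<not> (\<exists>p\<in>S. \<exists>q\<in>S. \<exists>t::real. p \<noteq> q \<and> 0 < t \<and> t < 1 \<and>
     f = (\<lambda>z\<in>unit_disc. of_real (1 - t) * p z + of_real t * q z))}"

text \<open>
  Not every \<open>P\<^sub>n\<close> and \<open>Q\<^sub>n\<close> is univalent, so \<^const>\<open>PQ\<close> need not lie inside \<^const>\<open>SH\<close>, and then it
  cannot be the set of extreme points of a subset of \<^const>\<open>SH\<close>. For even \<open>u - v\<close> the function \<open>Q\<^sub>1\<close>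
  is \<open>z \<plusminus> cnj z\<close>, whatever \<open>lam\<close> is; for \<open>lam = 0\<close> all \<open>P\<^sub>n\<close> with \<open>n \<ge> 2\<close> fail as well.
\<close>

lemma SH_inj_on: "f \<in> SH \<Longrightarrow> inj_on f unit_disc"
  by (auto simp: SH_def)

lemma Q_1_notin_SH: "Q_fun k 2 0 \<alpha> lam 1 \<notin> SH"
proof
  assume "Q_fun k 2 0 \<alpha> lam 1 \<in> SH"
  then have "inj_on (Q_fun k 2 0 \<alpha> lam 1) unit_disc" by (rule SH_inj_on)
  moreover have "Q_fun k 2 0 \<alpha> lam 1 (1/2) = Q_fun k 2 0 \<alpha> lam 1 0"
    by (simp add: Q_fun_def eta_def power_int_minus)
  ultimately have "(1/2 :: complex) = 0"
    by (rule inj_onD) (auto simp: norm_divide)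
  then show False by simp
qed

lemma P_2_notin_SH: "P_fun k u v \<alpha> 0 2 \<notin> SH"
proof
  assume "P_fun k u v \<alpha> 0 2 \<in> SH"
  then have "inj_on (P_fun k u v \<alpha> 0 2) unit_disc" by (rule SH_inj_on)
  moreover have "P_fun k u v \<alpha> 0 2 (1/4) = P_fun k u v \<alpha> 0 2 (3/4)"
    by (simp add: P_fun_def xi_def norm_divide power2_eq_square)
  ultimately have "(1/4 :: complex) = 3/4"
    by (rule inj_onD) (auto simp: norm_divide)
  then show False by simp
qed

end

theory Submission
  imports Defs
begin

text \<open>
The class \<^const>\<open>UTH\<close> is the part of \<^const>\<open>SH\<close> that lies in an infinite-dimensional simplex, and
everything follows from this description. A function with the prescribed signs of coefficients is
\<open>f(z) = z - \<Sum>n. A\<^sub>n z^(n+1) + (-1)^(u-1) cnj (\<Sum>n. B\<^sub>n z^(n+1))\<close> with \<open>A\<^sub>n, B\<^sub>n \<ge> 0\<close> and \<open>A\<^sub>0 = 0\<close>;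
indices are shifted by one throughout, so that \<open>\<xi>\<close> and \<open>\<eta>\<close> at \<open>n\<close> are the weights of \<open>z^(n+1)\<close>.
The condition in question is \<open>\<Sum>n. \<xi>\<^sub>n A\<^sub>n + \<eta>\<^sub>n B\<^sub>n \<le> 1\<close>, called \<open>admissible\<close> below.

\<^item> Setting \<open>x = \<xi> A\<close> and \<open>y = \<eta> B\<close>, with \<open>x\<^sub>0\<close> the slack in the inequality, turns the
  admissible functions into the infinite convex combinations of the \<open>P\<close>s and \<open>Q\<close>s and back
  (\<open>PQ_series_eq_admissible\<close>).

\<^item> A function of this form in \<^const>\<open>SH\<close> belongs to \<^const>\<open>USH\<close> iff it is admissible. If it belongs
  to \<^const>\<open>USH\<close>, then on the positive radius and for the angle \<open>\<phi> = 0\<close> the quotient of the two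
  operators is a quotient of real power series, and the defining inequality becomes
  \<open>\<Sum>n. (\<xi>\<^sub>n A\<^sub>n + \<eta>\<^sub>n B\<^sub>n) r^n \<le> 1\<close>; let \<open>r\<close> tend to 1 (\<open>USH_imp_admissible\<close>). Conversely, write
  \<open>N\<close>, \<open>D\<close> for the two operators applied to \<open>f\<close>, \<open>e = k exp(\<i>\<phi>)\<close>, and
  \<open>p = (1 + e) N - (e + \<alpha>) D\<close>. The quotient \<open>p/D\<close> has nonnegative real part iff
  \<open>\<bar>p - t D\<bar> \<le> \<bar>p + t D\<bar>\<close> for one (equivalently, every) \<open>t > 0\<close>. For \<open>t = 1 - \<alpha>\<close> the left-hand
  side is \<open>\<bar>(1 + e) (N - D)\<bar>\<close>, and estimating coefficient by coefficient loses nothing: the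
  difference of the two sides is at least \<open>2 (1 - \<alpha>) \<bar>z\<bar> (1 - \<Sum>n. (\<xi>\<^sub>n A\<^sub>n + \<eta>\<^sub>n B\<^sub>n) \<bar>z\<bar>^n)\<close>
  (\<open>admissible_imp_USH\<close>). The choice of \<open>t\<close> matters for this estimate: with \<open>t = 1\<close>, say,
  coefficients of indefinite sign appear, and their absolute values add up to too much.

Together these give \<open>UTH = SH \<inter> PQ_series\<close> (\<open>UTH_eq\<close>), hence the first assertion. The map from
weights to functions is affine and, by uniqueness of Taylor coefficients, injective; so the extreme
points of \<^const>\<open>PQ_series\<close> are the images of the vertices (\<open>extreme_points_PQ_series\<close>). Those among
them that lie in \<^const>\<open>SH\<close> remain extreme in the smaller set \<^const>\<open>UTH\<close>.

For the converse inclusion the simplex must not leave \<^const>\<open>SH\<close>. Both alternatives of the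
hypothesis give \<open>\<xi>\<^sub>n, \<eta>\<^sub>n \<ge> n + 1\<close> for \<open>n \<ge> 1\<close>, and then the classical condition
\<open>\<Sum>n. (n+1) (A\<^sub>n + B\<^sub>n) \<le> 1\<close> yields univalence as soon as \<open>B\<^sub>0 < 1\<close> (\<open>harm_series_SH\<close>). The
inequality \<open>B\<^sub>0 < 1\<close> can fail, namely at \<open>Q\<^sub>1\<close> when \<open>\<eta>\<^sub>0 = 1\<close>; but if \<open>f\<close> in \<^const>\<open>UTH\<close> is a proper
convex combination of two functions in the simplex, then it is the same combination of their
midpoints with \<open>f\<close>, and these satisfy \<open>B\<^sub>0 < 1\<close> (\<open>extreme_points_UTH_subset\<close>).
\<close>

section \<open>Power series with real coefficients on the unit disc\<close>

text \<open>
Convergence on the open unit disc, phrased through the absolute values on the positive radius so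
that it only speaks about the real coefficient sequence.
\<close>

definition disc_conv :: "(nat \<Rightarrow> real) \<Rightarrow> bool" where
  "disc_conv A \<longleftrightarrow> (\<forall>r. 0 \<le> r \<and> r < 1 \<longrightarrow> summable (\<lambda>n. \<bar>A n\<bar> * r ^ n))"

text \<open>
The constant term is left out: all functions of the class vanish at the origin.
\<close>

definition pser :: "(nat \<Rightarrow> real) \<Rightarrow> complex \<Rightarrow> complex" where
  "pser A z = (\<Sum>n. of_real (A n) * z ^ Suc n)"

lemma disc_conv_summable:
  assumes "summable A" "\<And>n. 0 \<le> A n"
  shows "disc_conv A"
  unfolding disc_conv_def
proof (intro allI impI)
  fix r :: real assume r: "0 \<le> r \<and> r < 1"
  show "summable (\<lambda>n. \<bar>A n\<bar> * r ^ n)"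
  proof (rule summable_comparison_test'[OF assms(1), where N = 0])
    fix n
    show "norm (\<bar>A n\<bar> * r ^ n) \<le> A n"
      using r assms(2)[of n] by (simp add: abs_mult mult_left_le power_le_one)
  qed
qed

lemma disc_conv_le:
  assumes "disc_conv B" "\<And>n. \<bar>A n\<bar> \<le> B n"
  shows "disc_conv A"
  unfolding disc_conv_def
proof (intro allI impI)
  fix r :: real assume r: "0 \<le> r \<and> r < 1"
  have "summable (\<lambda>n. \<bar>B n\<bar> * r ^ n)"
    using assms(1) r by (simp add: disc_conv_def)
  then show "summable (\<lambda>n. \<bar>A n\<bar> * r ^ n)"
    by (rule summable_comparison_test'[where N = 0])
      (use r order_trans[OF assms(2) abs_ge_self] in \<open>simp add: abs_mult mult_right_mono\<close>)
qed

lemma disc_conv_cmult: "disc_conv A \<Longrightarrow> disc_conv (\<lambda>n. c * A n)"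
  by (auto simp: disc_conv_def abs_mult mult.assoc intro: summable_mult)

lemma disc_conv_add:
  assumes "disc_conv A" "disc_conv B" shows "disc_conv (\<lambda>n. A n + B n)"
  unfolding disc_conv_def
proof (intro allI impI)
  fix r :: real assume r: "0 \<le> r \<and> r < 1"
  have "summable (\<lambda>n. \<bar>A n\<bar> * r ^ n + \<bar>B n\<bar> * r ^ n)"
    using assms r by (intro summable_add) (auto simp: disc_conv_def)
  then show "summable (\<lambda>n. \<bar>A n + B n\<bar> * r ^ n)"
    by (rule summable_comparison_test'[where N = 0])
      (use r abs_triangle_ineq in \<open>simp add: abs_mult mult_right_mono flip: distrib_right\<close>)
qed

text \<open>
Differentiating a power series does not shrink its disc of convergence.
\<close>

lemma disc_conv_of_nat_mult:
  assumes "disc_conv A" shows "disc_conv (\<lambda>n. real n * A n)"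
  unfolding disc_conv_def
proof (intro allI impI)
  fix r :: real assume r: "0 \<le> r \<and> r < 1"
  have "summable (\<lambda>n. \<bar>A n\<bar> * x ^ n)" if "norm x < 1" for x :: real
  proof (rule summable_comparison_test'[where N = 0])
    show "summable (\<lambda>n. \<bar>A n\<bar> * \<bar>x\<bar> ^ n)"
      using assms that by (simp add: disc_conv_def)
  qed (simp add: abs_mult power_abs)
  then have "summable (\<lambda>n. diffs (\<lambda>n. \<bar>A n\<bar>) n * r ^ n)"
    using r by (intro termdiff_converges[where K = 1]) auto
  then have "summable (\<lambda>n. diffs (\<lambda>n. \<bar>A n\<bar>) n * r ^ n * r)"
    by (rule summable_mult2)
  then have "summable (\<lambda>n. \<bar>real (Suc n) * A (Suc n)\<bar> * r ^ Suc n)"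
    by (simp add: diffs_def abs_mult mult_ac)
  then show "summable (\<lambda>n. \<bar>real n * A n\<bar> * r ^ n)"
    by (subst (asm) summable_Suc_iff)
qed

lemma disc_conv_Suc_mult:
  assumes "disc_conv A" shows "disc_conv (\<lambda>n. real (Suc n) * A n)"
proof -
  have "disc_conv (\<lambda>n. real n * A n + A n)"
    by (intro disc_conv_add disc_conv_of_nat_mult assms)
  then show ?thesis by (simp add: algebra_simps)
qed

text \<open>
The Al-Oboudi operator of order \<open>m\<close> is the \<open>m\<close>-th iterate of \<open>h \<mapsto> (1 - lam) h + lam z h'\<close>, so its
multipliers preserve convergence on the disc by repeated differentiation.
\<close>

lemma disc_conv_mult_power:
  assumes "disc_conv A" shows "disc_conv (\<lambda>n. (1 + real n * lam) ^ m * A n)"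
proof (induction m)
  case (Suc m)
  have "disc_conv (\<lambda>n. (1 + real n * lam) ^ m * A n + lam * (real n * ((1 + real n * lam) ^ m * A n)))"
    by (intro disc_conv_add disc_conv_cmult disc_conv_of_nat_mult Suc)
  also have "(\<lambda>n. (1 + real n * lam) ^ m * A n + lam * (real n * ((1 + real n * lam) ^ m * A n))) =
             (\<lambda>n. (1 + real n * lam) ^ Suc m * A n)"
    by (simp add: fun_eq_iff algebra_simps)
  finally show ?case .
qed (simp add: assms)

lemma summable_pser_norm:
  assumes "disc_conv A" "norm z < 1"
  shows "summable (\<lambda>n. norm (of_real (A n) * z ^ Suc n :: complex))"
proof -
  have "summable (\<lambda>n. \<bar>A n\<bar> * norm z ^ n * norm z)"
    using assms by (intro summable_mult2) (auto simp: disc_conv_def)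
  then show ?thesis by (simp add: norm_mult norm_power mult_ac)
qed

lemma sums_pser:
  assumes "disc_conv A" "norm z < 1"
  shows "(\<lambda>n. of_real (A n) * z ^ Suc n) sums pser A z"
  unfolding pser_def
  using summable_norm_cancel[OF summable_pser_norm[OF assms]] by (rule summable_sums)

lemma pser_0 [simp]: "pser A 0 = 0"
  by (simp add: pser_def)

lemma has_field_derivative_pser:
  assumes "disc_conv A" "norm z < 1"
  shows "(pser A has_field_derivative (\<Sum>n. of_real (real (Suc n) * A n) * z ^ n)) (at z)"
proof -
  define c where "c n = (if n = 0 then 0 else of_real (A (n - 1)) :: complex)" for n
  have s: "summable (\<lambda>n. c n * w ^ n)" if "norm w < 1" for w
  proof -
    have "summable (\<lambda>n. c (Suc n) * w ^ Suc n)"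
      using sums_pser[OF assms(1) that] by (simp add: c_def sums_iff)
    then show ?thesis by (subst (asm) summable_Suc_iff)
  qed
  have eq: "(\<Sum>n. c n * w ^ n) = pser A w" if "w \<in> ball 0 1" for w
    using suminf_split_head[OF s, of w] that by (simp add: c_def pser_def)
  have "((\<lambda>w. \<Sum>n. c n * w ^ n) has_field_derivative (\<Sum>n. diffs c n * z ^ n)) (at z)"
    using assms(2) by (intro termdiffs_strong'[where K = 1] s) auto
  then have "(pser A has_field_derivative (\<Sum>n. diffs c n * z ^ n)) (at z)"
    by (rule has_field_derivative_transform_within_open[where S = "ball 0 1"])
       (use assms eq in auto)
  also have "(\<lambda>n. diffs c n * z ^ n) = (\<lambda>n. of_real (real (Suc n) * A n) * z ^ n)"
    by (simp add: diffs_def c_def fun_eq_iff)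
  finally show ?thesis .
qed

lemma holomorphic_pser: "disc_conv A \<Longrightarrow> pser A holomorphic_on unit_disc"
  unfolding holomorphic_on_open[OF open_ball] using has_field_derivative_pser by fastforce

lemma has_fps_expansion_pser:
  assumes "disc_conv A"
  shows "pser A has_fps_expansion (Abs_fps (\<lambda>n. if n = 0 then 0 else of_real (A (n - 1))))"
    (is "_ has_fps_expansion ?F")
proof (rule has_fps_expansionI)
  have "(\<lambda>n. fps_nth ?F n * z ^ n) sums pser A z" if "z \<in> ball 0 1" for z
  proof -
    have "(\<lambda>n. fps_nth ?F (Suc n) * z ^ Suc n) sums pser A z"
      using sums_pser[OF assms] that by simp
    then show ?thesis by (subst (asm) sums_Suc_iff) simp
  qed
  moreover have "eventually (\<lambda>z::complex. z \<in> ball 0 1) (nhds 0)"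
    by (rule eventually_nhds_in_open) auto
  ultimately show "eventually (\<lambda>z. (\<lambda>n. fps_nth ?F n * z ^ n) sums pser A z) (nhds 0)"
    by (auto elim: eventually_mono)
qed

lemma fps_nth_fps_expansion_eqI:
  assumes "f has_fps_expansion F" "\<And>z. z \<in> unit_disc \<Longrightarrow> h z = f z"
  shows "fps_nth (fps_expansion h 0) n = fps_nth F n"
proof -
  have "eventually (\<lambda>z. h z = f z) (nhds 0)"
    using assms(2) by (auto intro!: eventually_mono[OF eventually_nhds_in_open[of unit_disc]])
  then have "fps_expansion h 0 = fps_expansion f 0" by (rule fps_expansion_cong)
  with fps_expansion_eqI[OF assms(1)] show ?thesis by simp
qed

lemma pser_eq_imp_coeff_eq:
  assumes "disc_conv A" "disc_conv B" "\<And>z. z \<in> unit_disc \<Longrightarrow> pser A z = pser B z"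
  shows "A = B"
proof
  fix n
  have "fps_nth (fps_expansion (pser A) 0) (Suc n) = of_real (B n)"
    by (subst fps_nth_fps_expansion_eqI[OF has_fps_expansion_pser[OF assms(2)]]) (use assms in auto)
  moreover have "fps_nth (fps_expansion (pser A) 0) (Suc n) = of_real (A n)"
    by (subst fps_nth_fps_expansion_eqI[OF has_fps_expansion_pser[OF assms(1)]]) auto
  ultimately have "of_real (A n) = (of_real (B n) :: complex)" by simp
  then show "A n = B n" by (simp only: of_real_eq_iff)
qed

lemma pser_add:
  assumes "disc_conv A" "disc_conv B" "norm z < 1"
  shows "pser (\<lambda>n. A n + B n) z = pser A z + pser B z"
  using sums_add[OF sums_pser[OF assms(1,3)] sums_pser[OF assms(2,3)]]
    sums_pser[OF disc_conv_add[OF assms(1,2)] assms(3)]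
  by (simp add: distrib_right sums_iff)

lemma pser_cmult:
  assumes "disc_conv A" "norm z < 1"
  shows "pser (\<lambda>n. c * A n) z = of_real c * pser A z"
  using sums_mult[OF sums_pser[OF assms], of "of_real c"]
    sums_pser[OF disc_conv_cmult[OF assms(1), of c] assms(2)]
  by (simp add: mult.assoc sums_iff)

lemma pser_of_real:
  assumes "disc_conv A" "0 \<le> r" "r < 1"
  shows "summable (\<lambda>n. A n * r ^ n)"
    and "pser A (of_real r) = of_real (r * (\<Sum>n. A n * r ^ n))"
proof -
  have "summable (\<lambda>n. \<bar>A n * r ^ n\<bar>)"
    using assms by (simp add: disc_conv_def abs_mult)
  then show sm: "summable (\<lambda>n. A n * r ^ n)" by (rule summable_rabs_cancel)
  have "(\<lambda>n. of_real (r * (A n * r ^ n)) :: complex) sums of_real (r * (\<Sum>n. A n * r ^ n))"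
    using sm by (intro sums_of_real sums_mult summable_sums)
  then have "(\<lambda>n. of_real (A n) * of_real r ^ Suc n :: complex) sums of_real (r * (\<Sum>n. A n * r ^ n))"
    by (simp add: mult_ac)
  then show "pser A (of_real r) = of_real (r * (\<Sum>n. A n * r ^ n))"
    by (simp add: pser_def sums_iff)
qed

lemma norm_pser_le:
  assumes "disc_conv A" "\<And>n. 0 \<le> A n" "norm z < 1"
  shows "norm (pser A z) \<le> norm z * (\<Sum>n. A n * norm z ^ n)"
proof -
  have sm: "summable (\<lambda>n. A n * norm z ^ n)"
    using assms by (intro pser_of_real) auto
  have eq: "norm (of_real (A n) * z ^ Suc n) = norm z * (A n * norm z ^ n)" for n
    using assms(2)[of n] by (simp add: norm_mult norm_power)
  have "norm (pser A z) \<le> (\<Sum>n. norm (of_real (A n) * z ^ Suc n))"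
    unfolding pser_def by (rule summable_norm[OF summable_pser_norm[OF assms(1,3)]])
  also have "\<dots> = norm z * (\<Sum>n. A n * norm z ^ n)"
    unfolding eq using sm by (rule suminf_mult)
  finally show ?thesis .
qed

lemma disc_conv_lincomb:
  "disc_conv A \<Longrightarrow> disc_conv B \<Longrightarrow> disc_conv (\<lambda>n. a * A n + b * B n)"
  by (intro disc_conv_add disc_conv_cmult)

lemma pser_lincomb:
  assumes "disc_conv A" "disc_conv B" "norm z < 1"
  shows "pser (\<lambda>n. a * A n + b * B n) z = of_real a * pser A z + of_real b * pser B z"
  using assms by (simp add: pser_add disc_conv_cmult pser_cmult)

text \<open>
Rescaling by \<open>r\<close> reduces this to the Lipschitz bound for powers on the closed unit disc.
\<close>

lemma norm_power_diff_le:
  fixes z w :: complex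
  assumes "norm z \<le> r" "norm w \<le> r"
  shows "norm (z ^ Suc n - w ^ Suc n) \<le> real (Suc n) * r ^ n * norm (z - w)"
proof (cases "r = 0")
  case True
  then show ?thesis using assms by simp
next
  case False
  then have r: "r > 0" using assms order_trans[OF norm_ge_zero assms(1)] by simp
  have "norm ((z / of_real r) ^ Suc n - (w / of_real r) ^ Suc n) \<le> real (Suc n) * norm (z / of_real r - w / of_real r)"
    using assms r by (intro norm_power_diff) (auto simp: norm_divide)
  then have "norm (z ^ Suc n - w ^ Suc n) / r ^ Suc n \<le> real (Suc n) * (norm (z - w) / r)"
    using r by (simp add: power_divide norm_divide norm_power norm_mult flip: diff_divide_distrib)
  then show ?thesis using r by (simp add: field_simps)
qed

text \<open>
The Lipschitz constant on the disc of radius \<open>r\<close> is the derivative at \<open>r\<close>, because the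
coefficients are nonnegative.
\<close>

lemma norm_pser_diff_le:
  assumes A: "disc_conv A" "\<And>n. 0 \<le> A n" and r: "norm z \<le> r" "norm w \<le> r" "r < 1"
  shows "norm (pser A z - pser A w) \<le> (\<Sum>n. real (Suc n) * A n * r ^ n) * norm (z - w)"
proof -
  have r0: "0 \<le> r" using r(1) order_trans[OF norm_ge_zero] by blast
  have sm: "summable (\<lambda>n. real (Suc n) * A n * r ^ n)"
    using pser_of_real(1)[OF disc_conv_Suc_mult[OF A(1)] r0 r(3)] .
  have "(\<lambda>n. of_real (A n) * z ^ Suc n - of_real (A n) * w ^ Suc n) sums (pser A z - pser A w)"
    using r by (intro sums_diff sums_pser A) auto
  then have eq: "pser A z - pser A w = (\<Sum>n. of_real (A n) * (z ^ Suc n - w ^ Suc n))"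
    by (simp add: sums_iff right_diff_distrib)
  have "norm (pser A z - pser A w) \<le> (\<Sum>n. real (Suc n) * A n * r ^ n * norm (z - w))"
    unfolding eq
  proof (rule norm_suminf_le)
    show "summable (\<lambda>n. real (Suc n) * A n * r ^ n * norm (z - w))" using sm by (rule summable_mult2)
    fix n
    have "A n * norm (z ^ Suc n - w ^ Suc n) \<le> A n * (real (Suc n) * r ^ n * norm (z - w))"
      by (intro mult_left_mono norm_power_diff_le r A)
    then show "norm (of_real (A n) * (z ^ Suc n - w ^ Suc n)) \<le> real (Suc n) * A n * r ^ n * norm (z - w)"
      using A(2)[of n] by (simp add: norm_mult mult_ac del: power_Suc of_nat_Suc)
  qed
  also have "\<dots> = (\<Sum>n. real (Suc n) * A n * r ^ n) * norm (z - w)"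
    using sm by (rule suminf_mult2[symmetric])
  finally show ?thesis .
qed

lemma norm_deriv_pser_le:
  assumes A: "disc_conv A" "\<And>n. 0 \<le> A n" and z: "norm z < 1"
  shows "norm (\<Sum>n. of_real (real (Suc n) * A n) * z ^ n :: complex) \<le> (\<Sum>n. real (Suc n) * A n * norm z ^ n)"
proof (rule norm_suminf_le)
  show "summable (\<lambda>n. real (Suc n) * A n * norm z ^ n)"
    using pser_of_real(1)[OF disc_conv_Suc_mult[OF A(1)] norm_ge_zero z] .
  show "norm (of_real (real (Suc n) * A n) * z ^ n) \<le> real (Suc n) * A n * norm z ^ n" for n
    using A(2)[of n] by (simp only: norm_mult norm_of_real norm_power) simp
qed

section \<open>Uniqueness of the harmonic decomposition\<close>

text \<open>
Both \<open>F + G\<close> and \<open>\<i> (F - G)\<close> are real-valued. A real-valued holomorphic function is constant, as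
otherwise its image would be open.
\<close>

lemma holomorphic_eq_cnj_imp_const:
  assumes F: "F holomorphic_on unit_disc" and G: "G holomorphic_on unit_disc"
    and eq: "\<And>z. z \<in> unit_disc \<Longrightarrow> F z = cnj (G z)"
    and z: "z \<in> unit_disc"
  shows "F z = F 0 \<and> G z = G 0"
proof -
  have const: "H constant_on unit_disc"
    if H: "H holomorphic_on unit_disc" and r: "\<And>z. z \<in> unit_disc \<Longrightarrow> Im (H z) = 0" for H
  proof (rule ccontr)
    assume "\<not> H constant_on unit_disc"
    then have "open (H ` unit_disc)"
      by (intro open_mapping_thm[OF H]) auto
    moreover have "H 0 \<in> H ` unit_disc" by simp
    ultimately obtain e where e: "e > 0" "ball (H 0) e \<subseteq> H ` unit_disc"
      by (rule openE)
    have "H 0 + of_real (e / 2) * \<i> \<in> ball (H 0) e"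
      using e(1) by (simp add: dist_norm norm_mult)
    with e(2) obtain w where "w \<in> unit_disc" "H w = H 0 + of_real (e / 2) * \<i>" by auto
    with r[of w] r[of 0] e(1) show False by simp
  qed
  have "(\<lambda>z. F z + G z) constant_on unit_disc"
    by (rule const) (use F G eq in \<open>auto intro!: holomorphic_intros\<close>)
  then have s: "F z + G z = F 0 + G 0"
    using z unfolding constant_on_def by (metis centre_in_ball zero_less_one)
  have "(\<lambda>z. \<i> * (F z - G z)) constant_on unit_disc"
    by (rule const) (use F G eq in \<open>auto intro!: holomorphic_intros\<close>)
  then have "\<i> * (F z - G z) = \<i> * (F 0 - G 0)"
    using z unfolding constant_on_def by (metis centre_in_ball zero_less_one)
  then have d: "F z - G z = F 0 - G 0" by simp
  have "2 * F z = 2 * F 0" "2 * G z = 2 * G 0" using s d by algebra+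
  then show ?thesis by simp
qed

text \<open>
The differences \<open>h - h'\<close> and \<open>g' - g\<close> are holomorphic and conjugate to each other, hence constant,
and the normalisation at the origin makes them vanish. This is what permits reading off the Taylor
coefficients of whatever decomposition a definition provides.
\<close>

lemma harmonic_parts_unique:
  assumes "harmonic_parts f h g" "harmonic_parts f h' g'" "z \<in> unit_disc"
  shows "h z = h' z \<and> g z = g' z"
proof -
  have *: "h w + cnj (g w) = h' w + cnj (g' w)" if "w \<in> unit_disc" for w
    using assms that unfolding harmonic_parts_def by metis
  have "h z - h' z = h 0 - h' 0 \<and> g' z - g z = g' 0 - g 0"
    by (rule holomorphic_eq_cnj_imp_const[where F = "\<lambda>z. h z - h' z" and G = "\<lambda>z. g' z - g z"])
       (use assms * in \<open>auto simp: harmonic_parts_def algebra_simps intro!: holomorphic_intros\<close>)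
  moreover have "g 0 = 0" "g' 0 = 0" using assms by (auto simp: harmonic_parts_def)
  moreover from *[of 0] this have "h 0 = h' 0" by simp
  ultimately show ?thesis by simp
qed

section \<open>Boundary passage and half-plane estimates\<close>

text \<open>
Every partial sum is the limit of the partial sums with \<open>r\<close> tending to 1, and those are dominated
by the full series with \<open>r\<close>.
\<close>

lemma nonneg_series_bounded_of_Abel_bounded:
  fixes W :: "nat \<Rightarrow> real"
  assumes W: "\<And>n. 0 \<le> W n"
    and abel: "\<And>r. 0 < r \<Longrightarrow> r < 1 \<Longrightarrow> summable (\<lambda>n. W n * r ^ n) \<and> (\<Sum>n. W n * r ^ n) \<le> C"
  shows "summable W" "suminf W \<le> C"
proof -
  have le: "sum W {..<N} \<le> C" for N
  proof (rule tendsto_upperbound)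
    show "((\<lambda>r. \<Sum>n<N. W n * r ^ n) \<longlongrightarrow> sum W {..<N}) (at_left 1)"
      by (auto intro!: tendsto_eq_intros)
    have "(\<Sum>n<N. W n * r ^ n) \<le> C" if "0 < r" "r < 1" for r
      using abel[OF that] that W
      by (intro order_trans[OF sum_le_suminf]) auto
    moreover have "eventually (\<lambda>r. 0 < r \<and> r < 1) (at_left (1::real))"
      using eventually_at_left_real[of 0 1] by (auto elim: eventually_mono)
    ultimately show "eventually (\<lambda>r. (\<Sum>n<N. W n * r ^ n) \<le> C) (at_left 1)"
      by (auto elim: eventually_mono)
  qed simp
  show "summable W"
    using W le[of "Suc _"] by (intro bounded_imp_summable[where B = C]) (auto simp only: lessThan_Suc_atMost)
  then show "suminf W \<le> C"
    using le by (rule suminf_le_const)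
qed

text \<open>
The point \<open>p / D\<close> is at least as close to \<open>t\<close> as to \<open>-t\<close>.
\<close>

lemma Re_divide_nonneg:
  fixes p D :: complex
  assumes "D \<noteq> 0" "0 < t" and le: "cmod (p - of_real t * D) \<le> cmod (p + of_real t * D)"
  shows "0 \<le> Re (p / D)"
proof -
  have "cmod (p / D - of_real t) \<le> cmod (p / D + of_real t)"
    using le \<open>D \<noteq> 0\<close> divide_right_mono[OF le, of "cmod D"]
    by (simp flip: norm_divide add: diff_divide_distrib add_divide_distrib)
  then have "(cmod (p / D - of_real t))\<^sup>2 \<le> (cmod (p / D + of_real t))\<^sup>2"
    by (rule power_mono) simp
  then have "0 \<le> t * Re (p / D)"
    by (simp add: cmod_power2) (simp add: power2_eq_square algebra_simps)
  with \<open>0 < t\<close> show ?thesis by (simp add: zero_le_mult_iff)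
qed

text \<open>
All mass outside the index 0 is damped by at least the factor \<open>r\<close>, and not all mass is at 0. This
is where strict inequalities on the open disc come from.
\<close>

lemma power_series_less_1:
  fixes W :: "nat \<Rightarrow> real"
  assumes W: "\<And>n. 0 \<le> W n" and "summable W" "suminf W \<le> 1" "W 0 < 1" "0 \<le> r" "r < 1"
  shows "(\<Sum>n. W n * r ^ n) < 1"
proof -
  have "disc_conv W" using assms by (intro disc_conv_summable)
  then have sm: "summable (\<lambda>n. W n * r ^ n)" using assms by (intro pser_of_real)
  have "(\<Sum>n. W n * r ^ n) = W 0 + (\<Sum>n. W (Suc n) * r ^ Suc n)"
    using suminf_split_head[OF sm] by simp
  also have "(\<Sum>n. W (Suc n) * r ^ Suc n) \<le> (\<Sum>n. r * W (Suc n))"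
  proof (rule suminf_le)
    show "W (Suc n) * r ^ Suc n \<le> r * W (Suc n)" for n
      using W[of "Suc n"] assms(5,6) power_le_one[of r n] mult_left_le[of "r ^ n" "r * W (Suc n)"]
      by (simp add: mult_ac)
    show "summable (\<lambda>n. W (Suc n) * r ^ Suc n)" using sm by (subst summable_Suc_iff)
    show "summable (\<lambda>n. r * W (Suc n))" using assms(2) by (intro summable_mult) (subst summable_Suc_iff)
  qed
  also have "\<dots> = r * (suminf W - W 0)"
    using assms(2) by (simp add: suminf_mult suminf_split_head summable_Suc_iff)
  also have "W 0 + \<dots> \<le> W 0 + r * (1 - W 0)"
    using assms by (intro add_left_mono mult_left_mono) auto
  also have "\<dots> = 1 - (1 - r) * (1 - W 0)" by (simp add: algebra_simps)
  also have "\<dots> < 1" using assms by simp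
  finally show ?thesis by simp
qed

section \<open>Extreme points of an affine image of an infinite simplex\<close>

text \<open>
A unit vector has no other representation as a convex combination, because its zero entries force
zero entries in both summands. A weight function that is not a unit vector has an entry strictly
between 0 and 1; splitting off that entry and renormalising the rest exhibits it as a proper convex
combination. An injective affine map carries both observations over to the image.
\<close>

lemma extreme_points_affine_image_of_simplex:
  fixes F :: "('i \<Rightarrow> real) \<Rightarrow> complex \<Rightarrow> complex" and \<Omega> :: "('i \<Rightarrow> real) set"
  assumes \<Omega>: "\<Omega> = {W. (\<forall>i. 0 \<le> W i) \<and> (W has_sum 1) UNIV}"
    and inj: "inj_on F \<Omega>"
    and affine: "\<And>W W' t. W \<in> \<Omega> \<Longrightarrow> W' \<in> \<Omega> \<Longrightarrow> 0 < t \<Longrightarrow> t < 1 \<Longrightarrow>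
      F (\<lambda>i. (1 - t) * W i + t * W' i) =
      (\<lambda>z\<in>unit_disc. of_real (1 - t) * F W z + of_real t * F W' z)"
  shows "extreme_points (F ` \<Omega>) = range (\<lambda>i. F (\<lambda>j. if j = i then 1 else 0))"
proof -
  define \<delta> where "\<delta> i j = (if j = i then 1 else 0 :: real)" for i j :: 'i
  have \<delta>_sum: "(\<delta> i has_sum 1) UNIV" for i
    by (rule has_sum_finite_neutralI[where B = "{i}"]) (auto simp: \<delta>_def)
  have \<delta>: "\<delta> i \<in> \<Omega>" for i using \<delta>_sum by (auto simp: \<Omega> \<delta>_def)
  have mix: "(\<lambda>i. (1 - t) * W i + t * W' i) \<in> \<Omega>"
    if "W \<in> \<Omega>" "W' \<in> \<Omega>" "0 < t" "t < 1" for W W' t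
    using that has_sum_add[OF has_sum_cmult_right[of W UNIV 1 "1 - t"] has_sum_cmult_right[of W' UNIV 1 t]]
    by (auto simp: \<Omega>)
  have supp: "W = \<delta> i" if W: "W \<in> \<Omega>" and z: "\<And>j. j \<noteq> i \<Longrightarrow> W j = 0" for W i
  proof -
    have "(W has_sum W i) UNIV"
      by (rule has_sum_finite_neutralI[where B = "{i}"]) (use z in auto)
    then have "W i = 1" using W has_sum_unique by (auto simp: \<Omega>)
    with z show ?thesis by (auto simp: \<delta>_def)
  qed
  have le1: "sum W I \<le> 1" if "W \<in> \<Omega>" "finite I" for W I
    using that by (intro has_sum_mono2[OF has_sum_finite]) (auto simp: \<Omega>)
  have "F (\<delta> i) \<in> extreme_points (F ` \<Omega>)" for i
    unfolding extreme_points_def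
  proof (intro CollectI conjI notI)
    show "F (\<delta> i) \<in> F ` \<Omega>" using \<delta> by blast
    assume "\<exists>p\<in>F ` \<Omega>. \<exists>q\<in>F ` \<Omega>. \<exists>t::real. p \<noteq> q \<and> 0 < t \<and> t < 1 \<and>
      F (\<delta> i) = (\<lambda>z\<in>unit_disc. of_real (1 - t) * p z + of_real t * q z)"
    then obtain W W' t where W: "W \<in> \<Omega>" "W' \<in> \<Omega>" "F W \<noteq> F W'" and t: "0 < t" "t < (1::real)"
      and eq: "F (\<delta> i) = (\<lambda>z\<in>unit_disc. of_real (1 - t) * F W z + of_real t * F W' z)"
      by blast
    have "\<delta> i = (\<lambda>i. (1 - t) * W i + t * W' i)"
      using eq affine[OF W(1,2) t] mix[OF W(1,2) t] \<delta> by (intro inj_onD[OF inj]) auto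
    then have comb: "\<delta> i j = (1 - t) * W j + t * W' j" for j by (rule fun_cong)
    have nn: "0 \<le> W j" "0 \<le> W' j" for j using W by (auto simp: \<Omega>)
    have zero: "W j = 0 \<and> W' j = 0" if "j \<noteq> i" for j
    proof -
      have "(1 - t) * W j + t * W' j = 0" using comb[of j] that by (simp add: \<delta>_def)
      then show ?thesis
        using nn[of j] t add_nonneg_eq_0_iff[of "(1 - t) * W j" "t * W' j"] by simp
    qed
    have "W = \<delta> i" "W' = \<delta> i" using zero by (auto intro!: supp W)
    then show False using W(3) by simp
  qed
  moreover have "f \<in> range (\<lambda>i. F (\<delta> i))" if f: "f \<in> extreme_points (F ` \<Omega>)" for f
  proof -
    obtain W where W: "W \<in> \<Omega>" "f = F W" using f by (auto simp: extreme_points_def)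
    have nn: "0 \<le> W i" for i using W by (auto simp: \<Omega>)
    have "\<not> (0 < W i \<and> W i < 1)" for i
    proof
      assume i: "0 < W i \<and> W i < 1"
      define W' where "W' j = (if j = i then 0 else W j / (1 - W i))" for j
      have "W' = (\<lambda>j. (W j + (- W i) * \<delta> i j) * inverse (1 - W i))"
        using i by (auto simp: W'_def \<delta>_def field_simps)
      moreover have "((\<lambda>j. (W j + (- W i) * \<delta> i j) * inverse (1 - W i)) has_sum
          (1 + (- W i) * 1) * inverse (1 - W i)) UNIV"
        using W by (intro has_sum_cmult_left has_sum_add has_sum_cmult_right \<delta>_sum) (auto simp: \<Omega>)
      ultimately have "(W' has_sum 1) UNIV" using i by simp
      then have W': "W' \<in> \<Omega>" using i nn by (auto simp: \<Omega> W'_def)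
      have "F (\<delta> i) \<noteq> F W'"
        using inj_onD[OF inj _ \<delta> W'] by (metis W'_def \<delta>_def zero_neq_one)
      moreover have "F W = F (\<lambda>j. (1 - (1 - W i)) * \<delta> i j + (1 - W i) * W' j)"
        using i by (intro arg_cong[of _ _ F]) (auto simp: W'_def \<delta>_def)
      then have "f = (\<lambda>z\<in>unit_disc. of_real (1 - (1 - W i)) * F (\<delta> i) z + of_real (1 - W i) * F W' z)"
        using affine[OF \<delta>[of i] W', of "1 - W i"] i W(2) by simp
      ultimately have "\<exists>t::real. F (\<delta> i) \<noteq> F W' \<and> 0 < t \<and> t < 1 \<and>
          f = (\<lambda>z\<in>unit_disc. of_real (1 - t) * F (\<delta> i) z + of_real t * F W' z)"
        using i by (intro exI[of _ "1 - W i"] conjI) simp_all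
      then show False
        using f \<delta>[of i] W' unfolding extreme_points_def by blast
    qed
    moreover have "W i \<le> 1" for i using le1[OF W(1), of "{i}"] by simp
    ultimately have 01: "W i = 0 \<or> W i = 1" for i using nn by (metis order_le_less)
    have "\<exists>i. W i \<noteq> 0"
    proof (rule ccontr)
      assume "\<nexists>i. W i \<noteq> 0"
      then have "(W has_sum 0) UNIV" by (auto intro!: has_sum_0)
      then show False using W(1) has_sum_unique by (fastforce simp: \<Omega>)
    qed
    then obtain i where i: "W i = 1" using 01 by auto
    have "W j = 0" if "j \<noteq> i" for j
      using le1[OF W(1), of "{i, j}"] that i nn[of j] by auto
    then show ?thesis using supp[OF W(1)] W(2) by blast
  qed
  ultimately show ?thesis unfolding \<delta>_def by blast
qed

text \<open>
The weights of the \<open>P\<close>s and the \<open>Q\<close>s form a single family over the index type \<^typ>\<open>nat + nat\<close>; for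
nonnegative families the unordered sum agrees with the series of the grouped terms.
\<close>

lemma has_sum_case_sum_iff:
  fixes x y :: "nat \<Rightarrow> real"
  assumes "\<And>n. 0 \<le> x n" "\<And>n. 0 \<le> y n"
  shows "(case_sum x y has_sum c) UNIV \<longleftrightarrow> (\<lambda>n. x n + y n) sums c"
proof
  assume "(\<lambda>n. x n + y n) sums c"
  moreover from this have "summable x" "summable y"
    using assms by (auto intro!: summable_comparison_test'[where N = 0, OF sums_summable])
  ultimately have "x sums suminf x" "y sums suminf y" "c = suminf x + suminf y"
    by (auto simp: sums_iff suminf_add)
  moreover from this have "(x has_sum suminf x) UNIV" "(y has_sum suminf y) UNIV"
    using assms by (auto intro!: sums_nonneg_imp_has_sum)
  then have "(case_sum x y has_sum suminf x + suminf y) (range Inl \<union> range Inr)"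
    by (intro has_sum_Un_disjoint) (auto simp: has_sum_reindex o_def)
  ultimately show "(case_sum x y has_sum c) UNIV"
    by (simp add: UNIV_sum)
next
  assume c: "(case_sum x y has_sum c) UNIV"
  then have "case_sum x y summable_on range Inl" "case_sum x y summable_on range Inr"
    by (auto intro: summable_on_subset_banach has_sum_imp_summable)
  then obtain a b where a: "(case_sum x y has_sum a) (range Inl)" and b: "(case_sum x y has_sum b) (range Inr)"
    by (auto simp: summable_on_def)
  then have "x sums a" "y sums b"
    by (auto simp: has_sum_reindex o_def dest!: has_sum_imp_sums)
  moreover have "(case_sum x y has_sum a + b) UNIV"
    unfolding UNIV_sum using a b by (rule has_sum_Un_disjoint) auto
  with c have "a + b = c" by (rule has_sum_unique[rotated])
  ultimately show "(\<lambda>n. x n + y n) sums c" using sums_add by blast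
qed

section \<open>Harmonic functions with prescribed coefficients\<close>

locale uniform_class =
  fixes lam \<alpha> k :: real and u v :: nat
  assumes lam: "0 \<le> lam" and \<alpha>0: "0 \<le> \<alpha>" and \<alpha>1: "\<alpha> < 1" and k: "0 \<le> k"
    and u1: "1 \<le> u" and vu: "v < u"
begin

text \<open>
The sign \<open>(-1)^(v-u)\<close> in the definition of \<^const>\<open>eta\<close>, in a form with a natural exponent.
\<close>

definition \<epsilon> :: real where "\<epsilon> = (-1) ^ (u - v)"

abbreviation mult_v :: "nat \<Rightarrow> real" where "mult_v n \<equiv> (1 + real n * lam) ^ v"
abbreviation mult_u :: "nat \<Rightarrow> real" where "mult_u n \<equiv> (1 + real n * lam) ^ u"
abbreviation \<xi> :: "nat \<Rightarrow> real" where "\<xi> n \<equiv> xi k u v \<alpha> lam (Suc n)"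
abbreviation \<eta> :: "nat \<Rightarrow> real" where "\<eta> n \<equiv> eta k u v \<alpha> lam (Suc n)"

lemma eps_cases: "\<epsilon> = 1 \<or> \<epsilon> = -1"
  by (simp add: \<epsilon>_def minus_one_power_iff)

lemma abs_eps: "\<bar>\<epsilon>\<bar> = 1" using eps_cases by auto

lemma powi_eq_eps: "(-1) powi (int v - int u) = \<epsilon>"
proof -
  have "int v - int u = - int (u - v)" using vu by simp
  then show ?thesis
    by (simp only: power_int_minus) (simp add: \<epsilon>_def minus_one_power_iff)
qed

lemma sign_u: "(-1) ^ u * (-1) ^ (u - 1) = (-1 :: complex)"
proof -
  have "(-1) ^ u = (-1 :: complex) * (-1) ^ (u - 1)"
    using u1 by (metis Suc_diff_1 power_Suc less_le_trans zero_less_one)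
  then show ?thesis by (simp add: minus_one_power_iff)
qed

lemma sign_v: "(-1) ^ v * (-1) ^ (u - 1) = (- of_real \<epsilon> :: complex)"
proof -
  have "(-1) ^ u = (-1 :: complex) ^ v * (-1) ^ (u - v)"
    using vu by (simp flip: power_add)
  then have "(-1) ^ v * (-1) ^ u = (of_real \<epsilon> :: complex)"
    by (simp add: \<epsilon>_def minus_one_power_iff)
  moreover have "(-1) ^ v * (-1) ^ (u - 1) = (-1) ^ v * (-1) ^ u * ((-1) ^ u * (-1) ^ (u - 1) :: complex)"
    by (simp add: minus_one_power_iff)
  ultimately show ?thesis by (simp only: sign_u) simp
qed

lemma norm_sign [simp]: "norm ((-1) ^ n :: complex) = 1"
  by (simp add: norm_power)

lemma xi_eq: "(1 - \<alpha>) * \<xi> n = (1 - \<alpha>) * mult_v n + (1 + k) * (mult_u n - mult_v n)"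
  using \<alpha>1 by (simp add: xi_def field_simps)

lemma eta_eq: "(1 - \<alpha>) * \<eta> n = (1 - \<alpha>) * (\<epsilon> * mult_v n) + (1 + k) * (mult_u n - \<epsilon> * mult_v n)"
  using \<alpha>1 by (simp add: eta_def powi_eq_eps field_simps)

lemma mult_v_ge_1: "1 \<le> mult_v n" and mult_u_ge_1: "1 \<le> mult_u n" and mult_v_le_mult_u: "mult_v n \<le> mult_u n"
  using lam vu by (auto intro!: one_le_power power_increasing)

text \<open>
The excess of the weight over the multiplier is a nonnegative multiple of a difference of
multipliers. Because of this bound and its analogue for \<^const>\<open>eta\<close>, admissible coefficients give
convergent series and a nonvanishing denominator.
\<close>

lemma mult_u_le_xi: "mult_u n \<le> \<xi> n"
proof -
  have "(1 - \<alpha>) * (\<xi> n - mult_u n) = (k + \<alpha>) * (mult_u n - mult_v n)"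
    using xi_eq[of n] by (simp add: algebra_simps)
  also have "\<dots> \<ge> 0" using mult_v_le_mult_u[of n] k \<alpha>0 by simp
  finally show ?thesis using \<alpha>1 by (simp add: zero_le_mult_iff)
qed

lemma eps_mult_v_le: "\<bar>\<epsilon> * mult_v n\<bar> \<le> mult_u n"
  using mult_v_le_mult_u[of n] mult_v_ge_1[of n] by (simp add: abs_mult abs_eps)

lemma mult_u_le_eta: "mult_u n \<le> \<eta> n"
proof -
  have "(1 - \<alpha>) * (\<eta> n - mult_u n) = (k + \<alpha>) * (mult_u n - \<epsilon> * mult_v n)"
    using eta_eq[of n] by (simp add: algebra_simps)
  also have "\<dots> \<ge> 0" using eps_mult_v_le[of n] k \<alpha>0 by simp
  finally show ?thesis using \<alpha>1 by (simp add: zero_le_mult_iff)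
qed

lemma xi_ge_1: "1 \<le> \<xi> n" and eta_ge_1: "1 \<le> \<eta> n"
  using mult_u_ge_1[of n] mult_u_le_xi[of n] mult_u_le_eta[of n] by auto

lemma xi_pos: "0 < \<xi> n" and eta_pos: "0 < \<eta> n"
  using xi_ge_1[of n] eta_ge_1[of n] by auto

definition harm_series :: "(nat \<Rightarrow> real) \<Rightarrow> (nat \<Rightarrow> real) \<Rightarrow> complex \<Rightarrow> complex" where
  "harm_series A B = (\<lambda>z\<in>unit_disc. z - pser A z + (-1) ^ (u - 1) * cnj (pser B z))"

lemma harmonic_parts_harm_series:
  assumes "disc_conv A" "disc_conv B"
  shows "harmonic_parts (harm_series A B) (\<lambda>z. z - pser A z) (\<lambda>z. (-1) ^ (u - 1) * pser B z)"
  unfolding harmonic_parts_def harm_series_def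
  using assms by (auto intro!: holomorphic_intros holomorphic_pser)

text \<open>
The decomposition into analytic and co-analytic part is unique, and so are Taylor coefficients.
\<close>

lemma harm_series_inject:
  assumes "disc_conv A" "disc_conv B" "disc_conv A'" "disc_conv B'"
    and "harm_series A B = harm_series A' B'"
  shows "A = A' \<and> B = B'"
proof -
  have "z - pser A z = z - pser A' z \<and> (-1) ^ (u - 1) * pser B z = (-1) ^ (u - 1) * pser B' z"
    if "z \<in> unit_disc" for z
    using harmonic_parts_unique[OF harmonic_parts_harm_series[OF assms(1,2)] _ that]
      harmonic_parts_harm_series[OF assms(3,4)] assms(5) by simp
  then show ?thesis using assms by (auto intro!: pser_eq_imp_coeff_eq)
qed

text \<open>
The operator is defined through the Taylor coefficients of \<open>h\<close> and \<open>g\<close>; by uniqueness of the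
decomposition these are the coefficients \<open>A\<close> and \<open>B\<close>, whichever \<open>h\<close> and \<open>g\<close> are given.
\<close>

lemma al_oboudi_parts:
  assumes conv: "disc_conv A" "disc_conv B" and hp: "harmonic_parts (harm_series A B) h g"
    and z: "z \<in> unit_disc"
  shows "al_oboudi_harm lam m h g z =
    z - pser (\<lambda>n. (1 + real n * lam) ^ m * A n) z
      + (-1) ^ m * (-1) ^ (u - 1) * cnj (pser (\<lambda>n. (1 + real n * lam) ^ m * B n) z)"
proof -
  have parts: "h w = w - pser A w" "g w = (-1) ^ (u - 1) * pser B w" if "w \<in> unit_disc" for w
    using harmonic_parts_unique[OF hp harmonic_parts_harm_series[OF conv] that] by auto
  have hn: "fps_nth (fps_expansion h 0) (Suc n) = (if n = 0 then 1 else 0) - of_real (A n)" for n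
    by (subst fps_nth_fps_expansion_eqI[OF has_fps_expansion_diff[OF has_fps_expansion_fps_X
        has_fps_expansion_pser[OF conv(1)]]]) (use parts in \<open>auto simp: fps_X_def\<close>)
  have gn: "fps_nth (fps_expansion g 0) (Suc n) = (-1) ^ (u - 1) * of_real (B n)" for n
    by (subst fps_nth_fps_expansion_eqI[OF has_fps_expansion_cmult_left[OF
        has_fps_expansion_pser[OF conv(2)]]]) (use parts in auto)
  have nz: "norm z < 1" using z by simp
  let ?l = "\<lambda>n. (1 + real n * lam) ^ m"
  have "(\<lambda>n. (if n = 0 then z else 0)) sums z"
    using sums_single[of 0 "\<lambda>_. z"] by simp
  from sums_diff[OF this sums_pser[OF disc_conv_mult_power[OF conv(1), of lam m] nz]]
  have "(\<lambda>n. of_real (?l n) * fps_nth (fps_expansion h 0) (Suc n) * z ^ Suc n) sums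
          (z - pser (\<lambda>n. ?l n * A n) z)"
    by (rule back_subst[where P = "\<lambda>f. f sums _"]) (auto simp: hn fun_eq_iff algebra_simps)
  then have H: "al_oboudi lam m h z = z - pser (\<lambda>n. ?l n * A n) z"
    by (simp add: al_oboudi_def sums_iff)
  from sums_mult[OF sums_pser[OF disc_conv_mult_power[OF conv(2), of lam m] nz], of "(-1) ^ (u - 1)"]
  have "(\<lambda>n. of_real (?l n) * fps_nth (fps_expansion g 0) (Suc n) * z ^ Suc n) sums
          ((-1) ^ (u - 1) * pser (\<lambda>n. ?l n * B n) z)"
    by (rule back_subst[where P = "\<lambda>f. f sums _"]) (auto simp: gn fun_eq_iff algebra_simps)
  then have G: "al_oboudi lam m g z = (-1) ^ (u - 1) * pser (\<lambda>n. ?l n * B n) z"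
    by (simp add: al_oboudi_def sums_iff)
  show ?thesis by (simp add: al_oboudi_harm_def H G)
qed

lemma al_oboudi_harm_numerator:
  assumes "disc_conv A" "disc_conv B" "harmonic_parts (harm_series A B) h g" "z \<in> unit_disc"
  shows "al_oboudi_harm lam u h g z = z - pser (\<lambda>n. mult_u n * A n) z - cnj (pser (\<lambda>n. mult_u n * B n) z)"
  using al_oboudi_parts[OF assms, of u] by (simp only: sign_u) simp

lemma al_oboudi_harm_denominator:
  assumes "disc_conv A" "disc_conv B" "harmonic_parts (harm_series A B) h g" "z \<in> unit_disc"
  shows "al_oboudi_harm lam v h g z =
    z - pser (\<lambda>n. mult_v n * A n) z - of_real \<epsilon> * cnj (pser (\<lambda>n. mult_v n * B n) z)"
  using al_oboudi_parts[OF assms, of v] by (simp only: sign_v) simp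

text \<open>
Sense-preservation at the origin, where \<open>\<bar>g'(0)\<bar> = B\<^sub>0\<close> and \<open>h'(0) = 1\<close>.
\<close>

lemma SH_harm_series_coeff_less_1:
  assumes "disc_conv A" "disc_conv B" "0 \<le> B 0" "harm_series A B \<in> SH"
  shows "B 0 < 1"
proof -
  obtain h g where hg: "harmonic_parts (harm_series A B) h g" "deriv h 0 = 1"
      "\<forall>z\<in>unit_disc. cmod (deriv g z) < cmod (deriv h z)"
    using assms(4) by (auto simp: SH_def)
  have g: "g z = (-1) ^ (u - 1) * pser B z" if "z \<in> unit_disc" for z
    using harmonic_parts_unique[OF hg(1) harmonic_parts_harm_series[OF assms(1,2)] that] by simp
  have "(pser B has_field_derivative of_real (B 0)) (at 0)"
    using has_field_derivative_pser[OF assms(2), of 0] by simp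
  from DERIV_cmult[OF this, of "(-1) ^ (u - 1)"]
  have "(g has_field_derivative (-1) ^ (u - 1) * of_real (B 0)) (at 0)"
    by (rule has_field_derivative_transform_within_open[where S = unit_disc]) (use g in auto)
  then have "deriv g 0 = (-1) ^ (u - 1) * of_real (B 0)" by (rule DERIV_imp_deriv)
  moreover have "cmod (deriv g 0) < cmod (deriv h 0)" using hg(3) by (rule bspec) simp
  ultimately have "cmod ((-1) ^ (u - 1) * of_real (B 0)) < 1" using hg(2) by simp
  then show ?thesis using assms(3) by (simp add: norm_mult)
qed

lemma harm_series_mix:
  assumes "disc_conv A" "disc_conv B" "disc_conv A'" "disc_conv B'"
  shows "harm_series (\<lambda>n. (1 - t) * A n + t * A' n) (\<lambda>n. (1 - t) * B n + t * B' n) =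
    (\<lambda>z\<in>unit_disc. of_real (1 - t) * harm_series A B z + of_real t * harm_series A' B' z)"
proof (rule extensionalityI[of _ unit_disc])
  fix z assume z: "z \<in> unit_disc"
  then have nz: "norm z < 1" by simp
  show "harm_series (\<lambda>n. (1 - t) * A n + t * A' n) (\<lambda>n. (1 - t) * B n + t * B' n) z =
    (\<lambda>z\<in>unit_disc. of_real (1 - t) * harm_series A B z + of_real t * harm_series A' B' z) z"
    using z by (simp add: harm_series_def pser_lincomb[OF assms(1,3) nz] pser_lincomb[OF assms(2,4) nz])
      (simp add: algebra_simps)
qed (auto simp: harm_series_def)

section \<open>The coefficient condition\<close>

text \<open>
The condition \<open>A 0 = 0\<close> encodes the normalisation of the linear term of the analytic part; it makes
the weight of that coefficient disappear from the sum.
\<close>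

definition admissible :: "(nat \<Rightarrow> real) \<Rightarrow> (nat \<Rightarrow> real) \<Rightarrow> bool" where
  "admissible A B \<longleftrightarrow> A 0 = 0 \<and> (\<forall>n. 0 \<le> A n \<and> 0 \<le> B n) \<and>
     summable (\<lambda>n. \<xi> n * A n + \<eta> n * B n) \<and> (\<Sum>n. \<xi> n * A n + \<eta> n * B n) \<le> 1"

lemma disc_conv_mult:
  assumes "disc_conv A"
  shows "disc_conv (\<lambda>n. mult_v n * A n)" "disc_conv (\<lambda>n. mult_u n * A n)"
  using disc_conv_mult_power[OF assms] by auto

lemma admissible_disc_conv:
  assumes "admissible A B" shows "disc_conv A" "disc_conv B"
proof -
  have "disc_conv (\<lambda>n. \<xi> n * A n + \<eta> n * B n)"
    using assms less_imp_le[OF xi_pos] less_imp_le[OF eta_pos]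
    by (intro disc_conv_summable) (auto simp: admissible_def)
  moreover have "\<bar>A n\<bar> \<le> \<xi> n * A n + \<eta> n * B n" "\<bar>B n\<bar> \<le> \<xi> n * A n + \<eta> n * B n" for n
    using mult_right_mono[OF xi_ge_1[of n], of "A n"] mult_right_mono[OF eta_ge_1[of n], of "B n"] assms
    by (auto simp: admissible_def dest: spec[of _ n])
  ultimately show "disc_conv A" "disc_conv B" by (auto intro: disc_conv_le)
qed

text \<open>
Restrict to \<open>z = r\<close> in \<open>(0, 1)\<close> and \<open>\<phi> = 0\<close>. Both operators are then real, equal to
\<open>r (1 - b r)\<close> and \<open>r (1 - a r)\<close>. The denominator is positive near 0 because \<open>B 0 < 1\<close>, and it
stays positive because it is continuous and never zero. Clearing it turns the defining inequality
into \<open>(1 + k) b(r) - (k + \<alpha>) a(r) \<le> 1 - \<alpha>\<close>, whose left-hand side is \<open>1 - \<alpha>\<close> times the weighted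
coefficient series at \<open>r\<close>.
\<close>

lemma USH_imp_admissible:
  assumes conv: "disc_conv A" "disc_conv B" and nn: "\<And>n. 0 \<le> A n" "\<And>n. 0 \<le> B n"
    and A0: "A 0 = 0" and B0: "B 0 < 1"
    and f: "harm_series A B \<in> USH k u v \<alpha> lam"
  shows "admissible A B"
proof -
  let ?W = "\<lambda>n. \<xi> n * A n + \<eta> n * B n"
  obtain h g where hp: "harmonic_parts (harm_series A B) h g" and
    all: "\<And>z \<phi>. z \<in> unit_disc - {0} \<Longrightarrow> al_oboudi_harm lam v h g z \<noteq> 0 \<and>
        Re ((1 + of_real k * exp (\<i> * of_real \<phi>)) *
              (al_oboudi_harm lam u h g z / al_oboudi_harm lam v h g z)
            - of_real k * exp (\<i> * of_real \<phi>)) \<ge> \<alpha>"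
    using f unfolding USH_def by blast
  define a where "a r = (\<Sum>n. (mult_v n * A n + \<epsilon> * (mult_v n * B n)) * r ^ n)" for r
  define b where "b r = (\<Sum>n. (mult_u n * A n + mult_u n * B n) * r ^ n)" for r
  note cc = disc_conv_mult[OF conv(1)] disc_conv_mult[OF conv(2)]
  have conva: "disc_conv (\<lambda>n. mult_v n * A n + \<epsilon> * (mult_v n * B n))"
    by (intro disc_conv_add disc_conv_cmult cc)
  have convb: "disc_conv (\<lambda>n. mult_u n * A n + mult_u n * B n)"
    by (intro disc_conv_add cc)
  have num: "al_oboudi_harm lam u h g (of_real r) = of_real (r * (1 - b r))"
    and den: "al_oboudi_harm lam v h g (of_real r) = of_real (r * (1 - a r))" if r: "0 < r" "r < 1" for r
  proof -
    have z: "norm (of_real r :: complex) < 1" "complex_of_real r \<in> unit_disc" using r by auto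
    have real: "cnj (pser X (of_real r)) = pser X (of_real r)" if "disc_conv X" for X
      using r by (simp add: pser_of_real(2)[OF that])
    have "of_real (r * a r) = pser (\<lambda>n. mult_v n * A n + \<epsilon> * (mult_v n * B n)) (of_real r)"
      using r pser_of_real(2)[OF conva, of r] by (simp add: a_def)
    also have "\<dots> = pser (\<lambda>n. mult_v n * A n) (of_real r) + of_real \<epsilon> * pser (\<lambda>n. mult_v n * B n) (of_real r)"
      using pser_add[OF cc(1) disc_conv_cmult[OF cc(3)] z(1)] pser_cmult[OF cc(3) z(1)] by simp
    finally have "of_real (r * a r) = \<dots>" .
    then show "al_oboudi_harm lam v h g (of_real r) = of_real (r * (1 - a r))"
      using al_oboudi_harm_denominator[OF conv hp z(2)] real[OF cc(3)] by (simp add: algebra_simps)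
    have "of_real (r * b r) = pser (\<lambda>n. mult_u n * A n) (of_real r) + pser (\<lambda>n. mult_u n * B n) (of_real r)"
      using r pser_of_real(2)[OF convb, of r] pser_add[OF cc(2) cc(4) z(1)] by (simp add: b_def)
    then show "al_oboudi_harm lam u h g (of_real r) = of_real (r * (1 - b r))"
      using al_oboudi_harm_numerator[OF conv hp z(2)] real[OF cc(4)] by (simp add: algebra_simps)
  qed
  have a_ne: "a r \<noteq> 1" if r: "0 < r" "r < 1" for r
    using all[of "of_real r" 0] den[OF r] r by auto
  have a0: "a 0 < 1"
    using eps_cases B0 nn(2)[of 0] unfolding a_def by (auto simp: powser_zero A0)
  \<comment> \<open>Otherwise the denominator vanishes somewhere on the way from 0 to \<open>r\<close>.\<close>
  have a_less: "a r < 1" if r: "0 < r" "r < 1" for r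
  proof (rule ccontr)
    assume "\<not> a r < 1"
    moreover have "isCont a x" if "0 \<le> x" "x \<le> r" for x
    proof -
      have "summable (\<lambda>n. (mult_v n * A n + \<epsilon> * (mult_v n * B n)) * ((1 + r) / 2) ^ n)"
        using r by (intro pser_of_real(1)[OF conva]) auto
      then show ?thesis unfolding a_def by (rule isCont_powser) (use r that in auto)
    qed
    ultimately obtain x where "0 \<le> x" "x \<le> r" "a x = 1"
      using IVT[of a 0 1 r] a0 r by auto
    with a_ne[of x] a0 r show False by (cases "x = 0") auto
  qed
  have bound: "summable (\<lambda>n. ?W n * r ^ n) \<and> (\<Sum>n. ?W n * r ^ n) \<le> 1" if r: "0 < r" "r < 1" for r
  proof -
    have sa: "(\<lambda>n. (mult_v n * A n + \<epsilon> * (mult_v n * B n)) * r ^ n) sums a r"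
      and sb: "(\<lambda>n. (mult_u n * A n + mult_u n * B n) * r ^ n) sums b r"
      unfolding a_def b_def using pser_of_real(1)[OF conva] pser_of_real(1)[OF convb] r
      by (auto intro!: summable_sums)
    \<comment> \<open>In this form the weights are the coefficients of the combination of \<open>b\<close> and \<open>a\<close> above.\<close>
    have x: "\<xi> n = ((1 + k) * mult_u n - (k + \<alpha>) * mult_v n) / (1 - \<alpha>)" for n
      using xi_eq[of n] \<alpha>1 by (simp add: field_simps)
    have y: "\<eta> n = ((1 + k) * mult_u n - (k + \<alpha>) * (\<epsilon> * mult_v n)) / (1 - \<alpha>)" for n
      using eta_eq[of n] \<alpha>1 by (simp add: field_simps)
    have "(\<lambda>n. ?W n * r ^ n) sums (((1 + k) * b r - (k + \<alpha>) * a r) / (1 - \<alpha>))"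
      using sums_divide[OF sums_diff[OF sums_mult[OF sb, of "1 + k"] sums_mult[OF sa, of "k + \<alpha>"]], of "1 - \<alpha>"]
      by (rule back_subst[where P = "\<lambda>f. f sums _"])
         (simp add: x y fun_eq_iff diff_divide_distrib add_divide_distrib algebra_simps)
    moreover have "((1 + k) * b r - (k + \<alpha>) * a r) / (1 - \<alpha>) \<le> 1"
    proof -
      define X where "X = (1 - b r) / (1 - a r)"
      have ratio: "al_oboudi_harm lam u h g (of_real r) / al_oboudi_harm lam v h g (of_real r) = of_real X"
        using r unfolding num[OF r] den[OF r] X_def by simp
      have "\<alpha> \<le> Re ((1 + of_real k * exp (\<i> * of_real 0)) * of_real X - of_real k * exp (\<i> * of_real 0))"
        using all[of "of_real r" 0] r unfolding ratio by auto
      then have "\<alpha> \<le> (1 + k) * ((1 - b r) / (1 - a r)) - k"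
        by (simp add: X_def [symmetric])
      then have "(k + \<alpha>) * (1 - a r) \<le> (1 + k) * (1 - b r)"
        using a_less[OF r] by (simp add: field_simps)
      then show ?thesis using \<alpha>1 by (simp add: field_simps)
    qed
    ultimately show ?thesis by (simp add: sums_iff)
  qed
  have W: "0 \<le> ?W n" for n
    using nn[of n] xi_pos[of n] eta_pos[of n] by simp
  show ?thesis
    using nonneg_series_bounded_of_Abel_bounded[OF W bound] nn A0 by (simp add: admissible_def)
qed

lemma admissible_weight_ge:
  assumes "admissible A B"
  shows "0 \<le> \<xi> n * A n + \<eta> n * B n" "mult_u n * (A n + B n) \<le> \<xi> n * A n + \<eta> n * B n"
proof -
  have nn: "0 \<le> A n" "0 \<le> B n" using assms by (auto simp: admissible_def)
  then show "0 \<le> \<xi> n * A n + \<eta> n * B n"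
    using xi_pos[of n] eta_pos[of n] by simp
  show "mult_u n * (A n + B n) \<le> \<xi> n * A n + \<eta> n * B n"
    using nn mult_right_mono[OF mult_u_le_xi[of n], of "A n"] mult_right_mono[OF mult_u_le_eta[of n], of "B n"]
    by (simp add: distrib_left)
qed

text \<open>
Used with the multipliers of the denominator operator, which makes that operator nonzero, and with
\<open>n + 1\<close>, which gives univalence. The hypothesis \<open>w 0 = 1\<close> replaces the weight \<open>\<eta> 0\<close> by 1, since
\<open>\<eta> 0 * B 0\<close> itself may equal 1.
\<close>

lemma admissible_weighted_less_1:
  assumes adm: "admissible A B" and B0: "B 0 < 1" and r: "0 \<le> r" "r < 1"
    and w0: "w 0 = 1" and w: "\<And>n. 0 \<le> w n" "\<And>n. w n * (A n + B n) \<le> \<xi> n * A n + \<eta> n * B n"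
  shows "(\<Sum>n. (w n * (A n + B n)) * r ^ n) < 1"
proof -
  have nn: "0 \<le> A n" "0 \<le> B n" for n using adm by (auto simp: admissible_def)
  have W: "0 \<le> w n * (A n + B n)" for n using nn w(1) by simp
  have sm: "summable (\<lambda>n. \<xi> n * A n + \<eta> n * B n)" using adm by (simp add: admissible_def)
  have sm': "summable (\<lambda>n. w n * (A n + B n))"
    using W w(2) by (intro summable_comparison_test'[OF sm, where N = 0]) auto
  have "(\<Sum>n. w n * (A n + B n)) \<le> (\<Sum>n. \<xi> n * A n + \<eta> n * B n)"
    by (rule suminf_le[OF w(2) sm' sm])
  also have "\<dots> \<le> 1" using adm by (simp add: admissible_def)
  finally have le: "(\<Sum>n. w n * (A n + B n)) \<le> 1" .
  have "w 0 * (A 0 + B 0) < 1" using adm B0 w0 by (simp add: admissible_def)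
  from power_series_less_1[OF W sm' le this r] show ?thesis .
qed

text \<open>
The coefficients of \<open>(1 + e) (N - D)\<close> and of \<open>2 (1 - \<alpha>) D + (1 + e) (N - D)\<close> beyond the leading
\<open>z\<close> are split into nonnegative sequences with constant factors 1, \<open>2 (1 - \<alpha>)\<close>, \<open>e\<close> or \<open>1 + e\<close>. The
triangle inequality then gives upper bounds that add up to \<open>2 (1 - \<alpha>) \<bar>z\<bar>\<close> times the weighted
coefficient series, which is at most the modulus of the leading term of the second function.
\<close>

lemma admissible_imp_USH:
  assumes adm: "admissible A B" and SH: "harm_series A B \<in> SH"
  shows "harm_series A B \<in> USH k u v \<alpha> lam"
proof -
  note conv = admissible_disc_conv[OF adm]
  note hp = harmonic_parts_harm_series[OF conv]
  note cc = disc_conv_mult[OF conv(1)] disc_conv_mult[OF conv(2)]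
  have nn: "0 \<le> A n" "0 \<le> B n" for n using adm by (auto simp: admissible_def)
  have B0: "B 0 < 1" using SH_harm_series_coeff_less_1[OF conv nn(2) SH] .
  have cnn: "0 \<le> mult_v n" for n using mult_v_ge_1[of n] by simp
  show ?thesis
    unfolding USH_def
  proof (intro CollectI conjI exI ballI allI)
    show "harm_series A B \<in> SH" by fact
    show "harmonic_parts (harm_series A B) (\<lambda>z. z - pser A z) (\<lambda>z. (-1) ^ (u - 1) * pser B z)" by fact
    fix z :: complex and \<phi> :: real
    assume z0: "z \<in> unit_disc - {0}"
    then have z: "z \<in> unit_disc" "norm z < 1" "0 < norm z" by auto
    define N where "N = al_oboudi_harm lam u (\<lambda>z. z - pser A z) (\<lambda>z. (-1) ^ (u - 1) * pser B z) z"
    define D where "D = al_oboudi_harm lam v (\<lambda>z. z - pser A z) (\<lambda>z. (-1) ^ (u - 1) * pser B z) z"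
    define e where "e = of_real k * exp (\<i> * of_real \<phi>)"
    define r where "r = norm z"
    have r: "0 < r" "r < 1" using z by (auto simp: r_def)
    have norm_e: "norm e = k" using k by (simp add: e_def norm_mult)
    have norm_1e: "norm (1 + e) \<le> 1 + k" using norm_triangle_ineq[of 1 e] norm_e by simp
    define pc qc pd qd where "pc = pser (\<lambda>n. mult_v n * A n) z" and "qc = pser (\<lambda>n. mult_v n * B n) z"
      and "pd = pser (\<lambda>n. mult_u n * A n) z" and "qd = pser (\<lambda>n. mult_u n * B n) z"
    have D: "D = z - pc - of_real \<epsilon> * cnj qc" and N: "N = z - pd - cnj qd"
      using al_oboudi_harm_denominator[OF conv hp z(1)] al_oboudi_harm_numerator[OF conv hp z(1)]
      by (simp_all add: D_def N_def pc_def qc_def pd_def qd_def)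
    have D_ne: "D \<noteq> 0"
    proof -
      have "mult_v n * (A n + B n) \<le> \<xi> n * A n + \<eta> n * B n" for n
        using admissible_weight_ge(2)[OF adm, of n] mult_right_mono[OF mult_v_le_mult_u[of n], of "A n + B n"] nn[of n]
        by simp
      from admissible_weighted_less_1[OF adm B0 less_imp_le[OF r(1)] r(2) _ cnn this]
      have less: "(\<Sum>n. mult_v n * (A n + B n) * r ^ n) < 1" by simp
      have "(\<Sum>n. mult_v n * (A n + B n) * r ^ n) = (\<Sum>n. mult_v n * A n * r ^ n) + (\<Sum>n. mult_v n * B n * r ^ n)"
        using pser_of_real(1)[OF cc(1) less_imp_le[OF r(1)] r(2)] pser_of_real(1)[OF cc(3) less_imp_le[OF r(1)] r(2)]
        by (subst suminf_add) (auto simp: algebra_simps)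
      moreover have "norm pc \<le> r * (\<Sum>n. mult_v n * A n * r ^ n)" "norm qc \<le> r * (\<Sum>n. mult_v n * B n * r ^ n)"
        unfolding pc_def qc_def r_def using cc cnn nn z(2) by (auto intro!: norm_pser_le)
      ultimately have "norm pc + norm qc \<le> r * (\<Sum>n. mult_v n * (A n + B n) * r ^ n)"
        by (simp add: distrib_left)
      also have "\<dots> < norm z" using less r by (simp add: r_def)
      finally have "norm (pc + of_real \<epsilon> * cnj qc) < norm z"
        using norm_triangle_ineq[of pc "of_real \<epsilon> * cnj qc"] by (simp add: norm_mult abs_eps)
      then show ?thesis unfolding D by (auto simp: algebra_simps)
    qed
    have "0 \<le> Re (((1 + e) * N - (e + of_real \<alpha>) * D) / D)"
    proof (rule Re_divide_nonneg[OF D_ne, where t = "1 - \<alpha>"])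
      show "0 < 1 - \<alpha>" using \<alpha>1 by simp
      \<comment> \<open>\<open>X1\<close>, \<open>X2\<close>: the analytic and co-analytic coefficients of \<open>D - N\<close>; \<open>X3\<close>: the sum of \<open>X2\<close> and
          the co-analytic coefficients of \<open>2 (1 - \<alpha>) (z - D)\<close>.\<close>
      define X1 where "X1 = (\<lambda>n. 1 * (mult_u n * A n) + (-1) * (mult_v n * A n))"
      define X2 where "X2 = (\<lambda>n. 1 * (mult_u n * B n) + (-\<epsilon>) * (mult_v n * B n))"
      define X3 where "X3 = (\<lambda>n. 1 * (mult_u n * B n) + ((1 - 2 * \<alpha>) * \<epsilon>) * (mult_v n * B n))"
      have cX: "disc_conv X1" "disc_conv X2" "disc_conv X3"
        unfolding X1_def X2_def X3_def by (intro disc_conv_lincomb cc)+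
      have nX: "0 \<le> X1 n" "0 \<le> X2 n" "0 \<le> X3 n" for n
      proof -
        show "0 \<le> X1 n" using mult_v_le_mult_u[of n] nn[of n] by (simp add: X1_def mult_right_mono)
        have "0 \<le> (mult_u n - \<epsilon> * mult_v n) * B n" using eps_mult_v_le[of n] nn[of n] by simp
        then show "0 \<le> X2 n" by (simp add: X2_def algebra_simps)
        \<comment> \<open>As \<open>\<bar>1 - 2 \<alpha>\<bar> \<le> 1\<close>, the sign of \<open>\<epsilon>\<close> does not endanger nonnegativity.\<close>
        have "\<bar>(1 - 2 * \<alpha>) * (\<epsilon> * mult_v n)\<bar> \<le> 1 * \<bar>\<epsilon> * mult_v n\<bar>"
          unfolding abs_mult[of "1 - 2 * \<alpha>"] using \<alpha>0 \<alpha>1 by (intro mult_right_mono) auto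
        then have "0 \<le> (mult_u n + (1 - 2 * \<alpha>) * (\<epsilon> * mult_v n)) * B n" using eps_mult_v_le[of n] nn[of n] by simp
        then show "0 \<le> X3 n" by (simp add: X3_def algebra_simps)
      qed
      have pX: "pser X1 z = pd - pc" "pser X2 z = qd - of_real \<epsilon> * qc"
          "pser X3 z = qd + (1 - 2 * of_real \<alpha>) * of_real \<epsilon> * qc"
        unfolding X1_def X2_def X3_def pser_lincomb[OF cc(2) cc(1) z(2)] pser_lincomb[OF cc(4) cc(3) z(2)]
        by (simp_all add: pd_def pc_def qd_def qc_def)
      define S where "S X = (\<Sum>n. X n * r ^ n)" for X :: "nat \<Rightarrow> real"
      have S: "(\<lambda>n. X n * r ^ n) sums S X" if "disc_conv X" for X
        unfolding S_def using pser_of_real(1)[OF that] r by (auto intro: summable_sums)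
      have nS: "norm (pser X z) \<le> r * S X" if "disc_conv X" "\<And>n. 0 \<le> X n" for X
        unfolding S_def r_def using that z(2) by (intro norm_pser_le) auto
      have "(\<lambda>n. (2 * (1 - \<alpha>)) * ((\<xi> n * A n + \<eta> n * B n) * r ^ n)) sums
          (2 * (1 - \<alpha>) * S (\<lambda>n. mult_v n * A n) + 2 * (1 + k) * S X1 + S X3 + (1 + 2 * k) * S X2)"
      proof -
        have eq: "(2 * (1 - \<alpha>)) * (\<xi> n * A n + \<eta> n * B n) =
            2 * (1 - \<alpha>) * (mult_v n * A n) + 2 * (1 + k) * X1 n + X3 n + (1 + 2 * k) * X2 n" for n
        proof -
          have "(2 * (1 - \<alpha>)) * (\<xi> n * A n + \<eta> n * B n) =
              2 * ((1 - \<alpha>) * \<xi> n) * A n + 2 * ((1 - \<alpha>) * \<eta> n) * B n"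
            by (simp add: algebra_simps)
          then show ?thesis
            unfolding xi_eq eta_eq X1_def X2_def X3_def by (simp add: algebra_simps)
        qed
        have eq': "(2 * (1 - \<alpha>)) * ((\<xi> n * A n + \<eta> n * B n) * r ^ n) =
          2 * (1 - \<alpha>) * (mult_v n * A n * r ^ n) + 2 * (1 + k) * (X1 n * r ^ n) + X3 n * r ^ n + (1 + 2 * k) * (X2 n * r ^ n)" for n
          using arg_cong[OF eq[of n], of "\<lambda>x. x * r ^ n"] by (simp add: algebra_simps)
        show ?thesis
          unfolding eq' by (intro sums_add sums_mult S cc cX)
      qed
      moreover have "(\<lambda>n. (2 * (1 - \<alpha>)) * ((\<xi> n * A n + \<eta> n * B n) * r ^ n)) sums
          (2 * (1 - \<alpha>) * S (\<lambda>n. \<xi> n * A n + \<eta> n * B n))"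
      proof -
        have "disc_conv (\<lambda>n. \<xi> n * A n + \<eta> n * B n)"
          using adm admissible_weight_ge(1)[OF adm] by (intro disc_conv_summable) (auto simp: admissible_def)
        from sums_mult[OF S[OF this]] show ?thesis .
      qed
      ultimately have "2 * (1 - \<alpha>) * S (\<lambda>n. mult_v n * A n) + 2 * (1 + k) * S X1 + S X3 + (1 + 2 * k) * S X2 =
          2 * (1 - \<alpha>) * S (\<lambda>n. \<xi> n * A n + \<eta> n * B n)"
        by (rule sums_unique2)
      also have "\<dots> \<le> 2 * (1 - \<alpha>) * 1"
      proof (rule mult_left_mono)
        have "S (\<lambda>n. \<xi> n * A n + \<eta> n * B n) \<le> (\<Sum>n. \<xi> n * A n + \<eta> n * B n)"
        proof (unfold S_def, rule suminf_le)
          have sm: "summable (\<lambda>n. \<xi> n * A n + \<eta> n * B n)" using adm by (simp add: admissible_def)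
          then show "summable (\<lambda>n. \<xi> n * A n + \<eta> n * B n)" .
          show "(\<xi> n * A n + \<eta> n * B n) * r ^ n \<le> \<xi> n * A n + \<eta> n * B n" for n
            using admissible_weight_ge(1)[OF adm, of n] r by (simp add: mult_left_le power_le_one)
          show "summable (\<lambda>n. (\<xi> n * A n + \<eta> n * B n) * r ^ n)"
            using pser_of_real(1)[OF disc_conv_summable[OF sm admissible_weight_ge(1)[OF adm]]] r by simp
        qed
        also have "\<dots> \<le> 1" using adm by (simp add: admissible_def)
        finally show "S (\<lambda>n. \<xi> n * A n + \<eta> n * B n) \<le> 1" .
      qed (use \<alpha>1 in simp)
      finally have total: "r * (2 * (1 - \<alpha>) * S (\<lambda>n. mult_v n * A n) + 2 * (1 + k) * S X1 + S X3 + (1 + 2 * k) * S X2)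
          \<le> r * (2 * (1 - \<alpha>))"
        using r by (simp add: mult_left_mono)
      define T where "T = (1 + e) * (pser X1 z + cnj (pser X2 z))"
      define T' where "T' = of_real (2 * (1 - \<alpha>)) * pc + (1 + e) * pser X1 z + cnj (pser X3 z) + e * cnj (pser X2 z)"
      have "norm T \<le> (1 + k) * (r * S X1 + r * S X2)"
        unfolding T_def norm_mult
        using norm_1e k norm_triangle_ineq[of "pser X1 z" "cnj (pser X2 z)"] nS[OF cX(1) nX(1)] nS[OF cX(2) nX(2)]
        by (intro mult_mono) auto
      moreover have "norm T' \<le> 2 * (1 - \<alpha>) * (r * S (\<lambda>n. mult_v n * A n)) + (1 + k) * (r * S X1) + r * S X3 + k * (r * S X2)"
      proof -
        have "norm (of_real (2 * (1 - \<alpha>)) * pc) \<le> 2 * (1 - \<alpha>) * (r * S (\<lambda>n. mult_v n * A n))"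
        proof -
          have "norm (of_real (2 * (1 - \<alpha>)) * pc) = 2 * (1 - \<alpha>) * norm pc"
            using \<alpha>1 unfolding norm_mult norm_of_real by simp
          then show ?thesis unfolding pc_def using \<alpha>1 nS[OF cc(1)] cnn nn by (simp add: mult_left_mono)
        qed
        moreover have "norm ((1 + e) * pser X1 z) \<le> (1 + k) * (r * S X1)"
          unfolding norm_mult using norm_1e k nS[OF cX(1) nX(1)] by (intro mult_mono) auto
        moreover have "norm (cnj (pser X3 z)) \<le> r * S X3" using nS[OF cX(3) nX(3)] by simp
        moreover have "norm (e * cnj (pser X2 z)) \<le> k * (r * S X2)"
          using nS[OF cX(2) nX(2)] k by (simp add: norm_mult norm_e mult_left_mono)
        ultimately show ?thesis unfolding T'_def
          by (intro order_trans[OF norm_triangle_ineq] add_mono)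
      qed
      ultimately have TT': "norm T + norm T' \<le> 2 * (1 - \<alpha>) * r"
        using total by (simp add: algebra_simps)
      \<comment> \<open>The leading \<open>z\<close> cancels in the first combination only.\<close>
      have m: "(1 + e) * N - (e + of_real \<alpha>) * D - of_real (1 - \<alpha>) * D = - T"
        unfolding T_def pX D N by (simp add: algebra_simps)
      have p: "(1 + e) * N - (e + of_real \<alpha>) * D + of_real (1 - \<alpha>) * D = of_real (2 * (1 - \<alpha>)) * z - T'"
        unfolding T'_def pX D N by (simp add: algebra_simps)
      have "norm (of_real (2 * (1 - \<alpha>)) * z) = 2 * (1 - \<alpha>) * r"
        using \<alpha>1 unfolding norm_mult norm_of_real r_def by simp
      then show "norm ((1 + e) * N - (e + of_real \<alpha>) * D - of_real (1 - \<alpha>) * D)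
          \<le> norm ((1 + e) * N - (e + of_real \<alpha>) * D + of_real (1 - \<alpha>) * D)"
        unfolding m p norm_minus_cancel
        using TT' norm_triangle_ineq2[of "of_real (2 * (1 - \<alpha>)) * z" T'] by linarith
    qed
    also have "((1 + e) * N - (e + of_real \<alpha>) * D) / D = (1 + e) * (N / D) - e - of_real \<alpha>"
      using D_ne by (simp add: field_simps)
    finally show "\<alpha> \<le> Re ((1 + of_real k * exp (\<i> * of_real \<phi>)) *
        (al_oboudi_harm lam u (\<lambda>z. z - pser A z) (\<lambda>z. (-1) ^ (u - 1) * pser B z) z /
         al_oboudi_harm lam v (\<lambda>z. z - pser A z) (\<lambda>z. (-1) ^ (u - 1) * pser B z) z)
        - of_real k * exp (\<i> * of_real \<phi>))"
      unfolding N_def [symmetric] D_def [symmetric] e_def [symmetric] by simp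
    show "al_oboudi_harm lam v (\<lambda>z. z - pser A z) (\<lambda>z. (-1) ^ (u - 1) * pser B z) z \<noteq> 0"
      using D_ne by (simp add: D_def)
  qed
qed

section \<open>Infinite convex combinations of the functions P and Q\<close>

definition weights :: "(nat \<Rightarrow> real) \<Rightarrow> (nat \<Rightarrow> real) \<Rightarrow> bool" where
  "weights x y \<longleftrightarrow> (\<forall>n. 0 \<le> x n \<and> 0 \<le> y n) \<and> (\<lambda>n. x n + y n) sums 1"

text \<open>
The weight at index 0 belongs to the identity function \<open>P\<^sub>1\<close>, which contributes no coefficient.
\<close>

definition coefA :: "(nat \<Rightarrow> real) \<Rightarrow> nat \<Rightarrow> real" where
  "coefA x n = (if n = 0 then 0 else x n / \<xi> n)"

definition coefB :: "(nat \<Rightarrow> real) \<Rightarrow> nat \<Rightarrow> real" where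
  "coefB y n = y n / \<eta> n"

abbreviation \<P> :: "nat \<Rightarrow> complex \<Rightarrow> complex" where "\<P> n \<equiv> P_fun k u v \<alpha> lam (n + 1)"
abbreviation \<Q> :: "nat \<Rightarrow> complex \<Rightarrow> complex" where "\<Q> n \<equiv> Q_fun k u v \<alpha> lam (n + 1)"

lemma weights_summable:
  assumes "weights x y" shows "summable x" "summable y" "suminf x + suminf y = 1"
proof -
  show "summable x" "summable y"
    using assms by (auto simp: weights_def intro!: summable_comparison_test'[where N = 0, OF sums_summable])
  then show "suminf x + suminf y = 1" using assms by (simp add: weights_def suminf_add sums_iff)
qed

lemma weights_imp_admissible:
  assumes w: "weights x y" shows "admissible (coefA x) (coefB y)"
proof -
  have nn: "0 \<le> x n" "0 \<le> y n" for n using w by (auto simp: weights_def)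
  have le: "\<xi> n * coefA x n + \<eta> n * coefB y n \<le> x n + y n" for n
    using xi_pos[of n] eta_pos[of n] nn by (simp add: coefA_def coefB_def)
  have ge: "0 \<le> \<xi> n * coefA x n + \<eta> n * coefB y n" for n
    using xi_pos[of n] eta_pos[of n] nn by (simp add: coefA_def coefB_def)
  have s: "summable (\<lambda>n. x n + y n)" "(\<Sum>n. x n + y n) = 1" using w by (auto simp: weights_def sums_iff)
  have sm: "summable (\<lambda>n. \<xi> n * coefA x n + \<eta> n * coefB y n)"
    using ge le by (intro summable_comparison_test'[OF s(1), where N = 0]) auto
  moreover have "(\<Sum>n. \<xi> n * coefA x n + \<eta> n * coefB y n) \<le> 1"
    using suminf_le[OF le sm s(1)] s(2) by simp
  ultimately show ?thesis
    using nn xi_pos eta_pos by (auto simp: admissible_def coefA_def coefB_def less_imp_le)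
qed

text \<open>
The slack in the inequality becomes the weight of the identity function.
\<close>

lemma admissible_imp_weights:
  assumes "admissible A B"
  obtains x y where "weights x y" "A = coefA x" "B = coefB y"
proof
  define S where "S = (\<Sum>n. \<xi> n * A n + \<eta> n * B n)"
  define x where "x n = (if n = 0 then 1 - S else \<xi> n * A n)" for n
  define y where "y n = \<eta> n * B n" for n
  have A0: "A 0 = 0" and nn: "0 \<le> A n" "0 \<le> B n" and S: "(\<lambda>n. \<xi> n * A n + \<eta> n * B n) sums S" "S \<le> 1" for n
    using assms by (auto simp: admissible_def S_def)
  have "(\<lambda>n. (if n = 0 then 1 - S else 0) + (\<xi> n * A n + \<eta> n * B n)) sums (1 - S + S)"
    using sums_single[of 0 "\<lambda>_. 1 - S"] by (intro sums_add S) simp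
  also have "(\<lambda>n. (if n = 0 then 1 - S else 0) + (\<xi> n * A n + \<eta> n * B n)) = (\<lambda>n. x n + y n)"
    by (auto simp: x_def y_def A0)
  finally show "weights x y"
    using nn S xi_pos eta_pos by (auto simp: weights_def x_def y_def less_imp_le)
  show "A = coefA x" "B = coefB y"
    using xi_pos eta_pos A0 by (auto simp: coefA_def coefB_def x_def y_def fun_eq_iff less_imp_neq[symmetric])
qed

text \<open>
Since the weights sum to 1, the linear terms of all \<open>P\<close>s and \<open>Q\<close>s add up to \<open>z\<close>.
\<close>

lemma sums_PQ_harm_series:
  assumes w: "weights x y" and z: "z \<in> unit_disc"
  shows "(\<lambda>n. of_real (x n) * \<P> n z + of_real (y n) * \<Q> n z) sums harm_series (coefA x) (coefB y) z"
proof -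
  have nz: "norm z < 1" using z by simp
  note conv = admissible_disc_conv[OF weights_imp_admissible[OF w]]
  have "(\<lambda>n. of_real (x n + y n) * z) sums (of_real 1 * z)"
    using w by (intro sums_mult2 sums_of_real) (auto simp: weights_def)
  moreover have "(\<lambda>n. (-1) ^ (u - 1) * cnj (of_real (coefB y n) * z ^ Suc n)) sums
      ((-1) ^ (u - 1) * cnj (pser (coefB y) z))"
    using sums_pser[OF conv(2) nz] by (intro sums_mult) (simp only: sums_cnj)
  ultimately have "(\<lambda>n. of_real (x n + y n) * z - of_real (coefA x n) * z ^ Suc n +
      (-1) ^ (u - 1) * cnj (of_real (coefB y n) * z ^ Suc n)) sums
      (of_real 1 * z - pser (coefA x) z + (-1) ^ (u - 1) * cnj (pser (coefB y) z))"
    by (intro sums_add sums_diff sums_pser[OF conv(1) nz])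
  then show ?thesis
    by (rule back_subst[where P = "\<lambda>p. (fst p) sums (snd p)" and a = "(_, _)" and b = "(_, _)", simplified fst_conv snd_conv])
       (use z in \<open>auto simp: harm_series_def P_fun_def Q_fun_def coefA_def coefB_def fun_eq_iff algebra_simps\<close>)
qed

lemma PQ_series_eq_weights:
  "PQ_series k u v \<alpha> lam = {harm_series (coefA x) (coefB y) | x y. weights x y}"
proof (intro equalityI subsetI)
  fix f assume "f \<in> PQ_series k u v \<alpha> lam"
  then obtain x y where f: "f \<in> extensional unit_disc" and nn: "\<forall>n\<ge>1. 0 \<le> x n \<and> 0 \<le> y n"
    and sm: "summable (\<lambda>n. x (n + 2))" "summable (\<lambda>n. y (n + 1))"
    and x1: "x 1 = 1 - (\<Sum>n. x (n + 2)) - (\<Sum>n. y (n + 1))"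
    and s: "\<forall>z\<in>unit_disc. (\<lambda>n. of_real (x (n + 1)) * \<P> n z + of_real (y (n + 1)) * \<Q> n z) sums f z"
    unfolding PQ_series_def by blast
  have "(\<lambda>n. x (Suc n + 1)) sums (\<Sum>n. x (n + 2))" using sm(1) by (simp add: summable_sums)
  then have "(\<lambda>n. x (n + 1)) sums ((\<Sum>n. x (n + 2)) + x 1)"
    using sums_Suc_iff[of "\<lambda>n. x (n + 1)"] by simp
  from sums_add[OF this summable_sums[OF sm(2)]]
  have w: "weights (\<lambda>n. x (n + 1)) (\<lambda>n. y (n + 1))"
    using nn x1 by (simp add: weights_def)
  have "f z = harm_series (coefA (\<lambda>n. x (n + 1))) (coefB (\<lambda>n. y (n + 1))) z" if "z \<in> unit_disc" for z
    using sums_unique2[OF s[rule_format, OF that] sums_PQ_harm_series[OF w that]] .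
  then have "f = harm_series (coefA (\<lambda>n. x (n + 1))) (coefB (\<lambda>n. y (n + 1)))"
    using f by (intro extensionalityI[of _ unit_disc]) (auto simp: harm_series_def)
  with w show "f \<in> {harm_series (coefA x) (coefB y) | x y. weights x y}" by blast
next
  fix f assume "f \<in> {harm_series (coefA x) (coefB y) | x y. weights x y}"
  then obtain x y where w: "weights x y" and f: "f = harm_series (coefA x) (coefB y)" by blast
  note sm = weights_summable[OF w]
  have "(\<Sum>n. x (Suc n)) = suminf x - x 0" using suminf_split_head[OF sm(1)] .
  moreover have "summable (\<lambda>n. x (Suc n))" using sm(1) by (subst summable_Suc_iff)
  ultimately show "f \<in> PQ_series k u v \<alpha> lam"
    unfolding PQ_series_def f using w sm sums_PQ_harm_series[OF w]
    by (intro CollectI conjI exI[of _ "\<lambda>n. x (n - 1)"] exI[of _ "\<lambda>n. y (n - 1)"])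
       (auto simp: weights_def numeral_2_eq_2, simp add: harm_series_def)
qed

lemma PQ_series_eq_admissible: "PQ_series k u v \<alpha> lam = {harm_series A B | A B. admissible A B}"
  unfolding PQ_series_eq_weights
  using weights_imp_admissible by (auto elim!: admissible_imp_weights)

text \<open>
This combines the two directions of the coefficient condition. The decomposition that witnesses
the signs of the coefficients may differ from the one used for the operator, which is harmless by
uniqueness.
\<close>

lemma UTH_eq: "UTH k u v \<alpha> lam = SH \<inter> PQ_series k u v \<alpha> lam"
proof (intro equalityI subsetI IntI)
  fix f assume f: "f \<in> UTH k u v \<alpha> lam"
  then have USH: "f \<in> USH k u v \<alpha> lam" by (simp add: UTH_def)
  then show "f \<in> SH" by (simp add: USH_def)
  obtain h g a b where hp: "harmonic_parts f h g" and nf: "neg_coeff_form u h g a b"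
    using f by (auto simp: UTH_def)
  define A where "A n = (if n = 0 then 0 else cmod (a (n + 1)))" for n
  define B where "B n = cmod (b (n + 1))" for n
  have a_sums: "(\<lambda>n. of_real (A n) * z ^ Suc n) sums (z - h z)" if "z \<in> unit_disc" for z
  proof -
    have "(\<lambda>n. of_real (A (Suc n)) * z ^ Suc (Suc n)) sums (z - h z)"
      using nf that by (simp add: neg_coeff_form_def A_def sums_iff numeral_2_eq_2)
    then show ?thesis by (subst (asm) sums_Suc_iff) (simp add: A_def)
  qed
  have b_sums: "(\<lambda>n. of_real (B n) * z ^ Suc n) sums ((-1) ^ (u - 1) * g z)" if "z \<in> unit_disc" for z
    using nf that by (simp add: neg_coeff_form_def B_def sums_iff flip: mult.assoc power_mult_distrib)
  have conv: "disc_conv X"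
    if X: "\<And>n. 0 \<le> X n" "\<And>z::complex. z \<in> unit_disc \<Longrightarrow> summable (\<lambda>n. of_real (X n) * z ^ Suc n)" for X
    unfolding disc_conv_def
  proof (intro allI impI)
    fix r :: real assume r: "0 \<le> r \<and> r < 1"
    show "summable (\<lambda>n. \<bar>X n\<bar> * r ^ n)"
    proof (cases "r = 0")
      case True
      then show ?thesis using sums_summable[OF powser_sums_zero] by simp
    next
      case False
      have "summable (\<lambda>n. of_real (X n) * complex_of_real r ^ Suc n * inverse (of_real r))"
        using X(2)[of "of_real r"] r by (intro summable_mult2) auto
      then have "summable (\<lambda>n. complex_of_real (X n * r ^ n))"
        using False by (simp add: field_simps)
      then show ?thesis using X(1) by (simp only: summable_of_real_iff abs_of_nonneg)
    qed
  qed
  have cA: "disc_conv A" and cB: "disc_conv B"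
    using a_sums b_sums by (auto intro!: conv simp: A_def B_def sums_iff)
  have "f = harm_series A B"
  proof (rule extensionalityI[of _ unit_disc])
    fix z assume z: "z \<in> unit_disc"
    have "pser A z = z - h z" "pser B z = (-1) ^ (u - 1) * g z"
      using a_sums[OF z] b_sums[OF z] by (auto simp: pser_def sums_iff)
    then show "f z = harm_series A B z"
      using hp z by (simp add: harm_series_def harmonic_parts_def flip: mult.assoc power_mult_distrib)
  qed (use hp in \<open>auto simp: harmonic_parts_def harm_series_def\<close>)
  moreover from this have "admissible A B"
    using USH nf by (intro USH_imp_admissible cA cB) (auto simp: A_def B_def neg_coeff_form_def)
  ultimately show "f \<in> PQ_series k u v \<alpha> lam"
    unfolding PQ_series_eq_admissible by blast
next
  fix f assume "f \<in> SH \<inter> PQ_series k u v \<alpha> lam"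
  then obtain A B where adm: "admissible A B" and f: "f = harm_series A B" "harm_series A B \<in> SH"
    unfolding PQ_series_eq_admissible by blast
  note conv = admissible_disc_conv[OF adm]
  have nn: "0 \<le> A n" "0 \<le> B n" and A0: "A 0 = 0" for n using adm by (auto simp: admissible_def)
  have "B 0 < 1" using SH_harm_series_coeff_less_1[OF conv nn(2) f(2)] .
  moreover have "(\<lambda>n. of_real (A (Suc n)) * z ^ Suc (Suc n)) sums pser A z" if "z \<in> unit_disc" for z
    using sums_pser[OF conv(1), of z] that A0 by (subst sums_Suc_iff) simp
  ultimately have "neg_coeff_form u (\<lambda>z. z - pser A z) (\<lambda>z. (-1) ^ (u - 1) * pser B z)
      (\<lambda>n. of_real (A (n - 1))) (\<lambda>n. of_real (B (n - 1)))"
    using sums_pser[OF conv(2)] nn by (simp add: neg_coeff_form_def sums_iff numeral_2_eq_2)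
  then show "f \<in> UTH k u v \<alpha> lam"
    unfolding UTH_def using admissible_imp_USH[OF adm f(2)] harmonic_parts_harm_series[OF conv] f(1) by blast
qed

text \<open>
The infinite convex combination with unit weight at one function is that function.
\<close>

lemma harm_series_vertices:
  "weights (\<lambda>m. if m = n then 1 else 0) (\<lambda>_. 0)"
  "weights (\<lambda>_. 0) (\<lambda>m. if m = n then 1 else 0)"
  "harm_series (coefA (\<lambda>m. if m = n then 1 else 0)) (coefB (\<lambda>_. 0)) = \<P> n"
  "harm_series (coefA (\<lambda>_. 0)) (coefB (\<lambda>m. if m = n then 1 else 0)) = \<Q> n"
proof -
  show w: "weights (\<lambda>m. if m = n then 1 else 0) (\<lambda>_. 0)" "weights (\<lambda>_. 0) (\<lambda>m. if m = n then 1 else 0)"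
    using sums_single[of n "\<lambda>_. 1 :: real"] by (auto simp: weights_def)
  have if_of_real: "of_real (if m = n then 1 else 0) * c = (if m = n then c else 0)" for m and c :: complex
    by simp
  show "harm_series (coefA (\<lambda>m. if m = n then 1 else 0)) (coefB (\<lambda>_. 0)) = \<P> n"
  proof (rule extensionalityI[of _ unit_disc])
    fix z assume z: "z \<in> unit_disc"
    show "harm_series (coefA (\<lambda>m. if m = n then 1 else 0)) (coefB (\<lambda>_. 0)) z = \<P> n z"
      using sums_PQ_harm_series[OF w(1) z] sums_single[of n "\<lambda>m. \<P> m z"]
      unfolding if_of_real by (auto intro: sums_unique2)
  qed (auto simp: harm_series_def P_fun_def)
  show "harm_series (coefA (\<lambda>_. 0)) (coefB (\<lambda>m. if m = n then 1 else 0)) = \<Q> n"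
  proof (rule extensionalityI[of _ unit_disc])
    fix z assume z: "z \<in> unit_disc"
    show "harm_series (coefA (\<lambda>_. 0)) (coefB (\<lambda>m. if m = n then 1 else 0)) z = \<Q> n z"
      using sums_PQ_harm_series[OF w(2) z] sums_single[of n "\<lambda>m. \<Q> m z"]
      unfolding if_of_real by (auto intro: sums_unique2)
  qed (auto simp: harm_series_def Q_fun_def)
qed

text \<open>
The coefficients determine all weights except that of the identity function, and that one is
determined by the total being 1.
\<close>

lemma weights_inject:
  assumes w: "weights x y" "weights x' y'"
    and eq: "harm_series (coefA x) (coefB y) = harm_series (coefA x') (coefB y')"
  shows "x = x' \<and> y = y'"
proof -
  have eqs: "coefA x = coefA x'" "coefB y = coefB y'"
    using harm_series_inject[OF admissible_disc_conv[OF weights_imp_admissible[OF w(1)]]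
      admissible_disc_conv[OF weights_imp_admissible[OF w(2)]] eq] by auto
  have y: "y = y'"
  proof
    fix n show "y n = y' n" using fun_cong[OF eqs(2), of n] eta_pos[of n] by (simp add: coefB_def)
  qed
  have xS: "x (Suc n) = x' (Suc n)" for n
    using fun_cong[OF eqs(1), of "Suc n"] xi_pos[of "Suc n"] by (simp add: coefA_def)
  have "suminf x = suminf x'" using weights_summable(3)[OF w(1)] weights_summable(3)[OF w(2)] y by simp
  moreover have "(\<Sum>n. x (Suc n)) = suminf x - x 0" "(\<Sum>n. x' (Suc n)) = suminf x' - x' 0"
    using suminf_split_head weights_summable[OF w(1)] weights_summable[OF w(2)] by auto
  ultimately have "x 0 = x' 0" using xS by simp
  then have "x n = x' n" for n using xS by (cases n) auto
  with y show ?thesis by auto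
qed

lemma extreme_points_PQ_series: "extreme_points (PQ_series k u v \<alpha> lam) = PQ k u v \<alpha> lam"
proof -
  define \<Omega> :: "(nat + nat \<Rightarrow> real) set" where "\<Omega> = {W. (\<forall>i. 0 \<le> W i) \<and> (W has_sum 1) UNIV}"
  define F where "F W = harm_series (coefA (\<lambda>n. W (Inl n))) (coefB (\<lambda>n. W (Inr n)))" for W :: "nat + nat \<Rightarrow> real"
  have case_sum: "case_sum (\<lambda>n. W (Inl n)) (\<lambda>n. W (Inr n)) = W" for W :: "nat + nat \<Rightarrow> real"
    by (auto simp: fun_eq_iff split: sum.splits)
  have \<Omega>_iff: "W \<in> \<Omega> \<longleftrightarrow> weights (\<lambda>n. W (Inl n)) (\<lambda>n. W (Inr n))" for W
  proof -
    have "(\<forall>i. 0 \<le> W i) \<longleftrightarrow> (\<forall>n. 0 \<le> W (Inl n) \<and> 0 \<le> W (Inr n))" by (metis sum.exhaust)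
    then show ?thesis
      using has_sum_case_sum_iff[of "\<lambda>n. W (Inl n)" "\<lambda>n. W (Inr n)" 1]
      unfolding \<Omega>_def weights_def case_sum by auto
  qed
  have "F ` \<Omega> = PQ_series k u v \<alpha> lam"
  proof -
    have "harm_series (coefA x) (coefB y) \<in> F ` \<Omega>" if "weights x y" for x y
      using that by (intro image_eqI[of _ _ "case_sum x y"]) (auto simp: F_def \<Omega>_iff)
    moreover have "F W \<in> PQ_series k u v \<alpha> lam" if "W \<in> \<Omega>" for W
      using that unfolding PQ_series_eq_weights F_def \<Omega>_iff by blast
    ultimately show ?thesis unfolding PQ_series_eq_weights by auto
  qed
  moreover have "extreme_points (F ` \<Omega>) = range (\<lambda>i. F (\<lambda>j. if j = i then 1 else 0))"
  proof (rule extreme_points_affine_image_of_simplex[OF \<Omega>_def])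
    show "inj_on F \<Omega>"
    proof (rule inj_onI)
      fix W W' assume "W \<in> \<Omega>" "W' \<in> \<Omega>" "F W = F W'"
      then have "(\<lambda>n. W (Inl n)) = (\<lambda>n. W' (Inl n)) \<and> (\<lambda>n. W (Inr n)) = (\<lambda>n. W' (Inr n))"
        by (intro weights_inject) (auto simp: F_def \<Omega>_iff)
      then show "W = W'" by (metis case_sum)
    qed
    fix W W' t assume "W \<in> \<Omega>" "W' \<in> \<Omega>"
    then have "weights (\<lambda>n. W (Inl n)) (\<lambda>n. W (Inr n))" "weights (\<lambda>n. W' (Inl n)) (\<lambda>n. W' (Inr n))"
      by (auto simp: \<Omega>_iff)
    note conv = this[THEN weights_imp_admissible, THEN admissible_disc_conv(1)]
      this[THEN weights_imp_admissible, THEN admissible_disc_conv(2)]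
    have "coefA (\<lambda>n. (1 - t) * W (Inl n) + t * W' (Inl n)) =
        (\<lambda>n. (1 - t) * coefA (\<lambda>n. W (Inl n)) n + t * coefA (\<lambda>n. W' (Inl n)) n)"
      "coefB (\<lambda>n. (1 - t) * W (Inr n) + t * W' (Inr n)) =
        (\<lambda>n. (1 - t) * coefB (\<lambda>n. W (Inr n)) n + t * coefB (\<lambda>n. W' (Inr n)) n)"
      by (auto simp: coefA_def coefB_def add_divide_distrib)
    then show "F (\<lambda>i. (1 - t) * W i + t * W' i) =
        (\<lambda>z\<in>unit_disc. of_real (1 - t) * F W z + of_real t * F W' z)"
      unfolding F_def using harm_series_mix[OF conv(1,3,2,4)] by simp
  qed
  moreover have "range (\<lambda>i. F (\<lambda>j. if j = i then 1 else 0)) = PQ k u v \<alpha> lam"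
  proof -
    have "F (\<lambda>j. if j = Inl n then 1 else 0) = \<P> n" "F (\<lambda>j. if j = Inr n then 1 else 0) = \<Q> n" for n
      using harm_series_vertices(3,4)[of n] by (simp_all add: F_def)
    moreover have "{1..} = range (\<lambda>n::nat. n + 1)"
      by (auto simp: image_iff) (metis Suc_le_D One_nat_def)
    ultimately show ?thesis
      unfolding PQ_def by (simp add: UNIV_sum image_Un image_image)
  qed
  ultimately show ?thesis by simp
qed

section \<open>Univalence under linear growth of the weights\<close>

text \<open>
Writing \<open>a(r)\<close> and \<open>b(r)\<close> for the derivatives at \<open>r\<close> of the two coefficient series, the growth
hypothesis gives \<open>a(r) + b(r) < 1\<close> for \<open>r < 1\<close>. Then \<open>f\<close> differs from the identity by a map with
Lipschitz constant less than 1 on each smaller disc, so it is injective; and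
\<open>\<bar>g'\<bar> \<le> b(\<bar>z\<bar>) < 1 - a(\<bar>z\<bar>) \<le> \<bar>h'\<bar>\<close> is sense-preservation.
\<close>

lemma harm_series_SH:
  assumes adm: "admissible A B" and B0: "B 0 < 1"
    and growth: "\<And>n. real (Suc n) * (A n + B n) \<le> \<xi> n * A n + \<eta> n * B n"
  shows "harm_series A B \<in> SH"
proof -
  note conv = admissible_disc_conv[OF adm]
  have nn: "0 \<le> A n" "0 \<le> B n" and A0: "A 0 = 0" for n using adm by (auto simp: admissible_def)
  define a where "a r = (\<Sum>n. real (Suc n) * A n * r ^ n)" for r
  define b where "b r = (\<Sum>n. real (Suc n) * B n * r ^ n)" for r
  have ab: "a r + b r < 1" if r: "0 \<le> r" "r < 1" for r
  proof -
    have "summable (\<lambda>n. real (Suc n) * A n * r ^ n)" "summable (\<lambda>n. real (Suc n) * B n * r ^ n)"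
      using pser_of_real(1)[OF disc_conv_Suc_mult[OF conv(1)] r] pser_of_real(1)[OF disc_conv_Suc_mult[OF conv(2)] r]
      by auto
    then have "a r + b r = (\<Sum>n. real (Suc n) * (A n + B n) * r ^ n)"
      unfolding a_def b_def by (subst suminf_add) (auto simp: algebra_simps)
    also have "\<dots> < 1"
      by (rule admissible_weighted_less_1[OF adm B0 r _ _ growth]) auto
    finally show ?thesis .
  qed
  have dA: "(pser A has_field_derivative (\<Sum>n. of_real (real (Suc n) * A n) * z ^ n)) (at z)"
    and dB: "(pser B has_field_derivative (\<Sum>n. of_real (real (Suc n) * B n) * z ^ n)) (at z)"
    if "norm z < 1" for z
    using that by (intro has_field_derivative_pser conv; simp)+
  have dh: "deriv (\<lambda>z. z - pser A z) z = 1 - (\<Sum>n. of_real (real (Suc n) * A n) * z ^ n)"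
    and dg: "deriv (\<lambda>z. (-1) ^ (u - 1) * pser B z) z = (-1) ^ (u - 1) * (\<Sum>n. of_real (real (Suc n) * B n) * z ^ n)"
    if "norm z < 1" for z
    using DERIV_imp_deriv[OF DERIV_diff[OF DERIV_ident dA[OF that]]]
      DERIV_imp_deriv[OF DERIV_cmult[OF dB[OF that]]] by simp_all
  have sense: "cmod (deriv (\<lambda>z. (-1) ^ (u - 1) * pser B z) z) < cmod (deriv (\<lambda>z. z - pser A z) z)"
    if z: "z \<in> unit_disc" for z
  proof -
    have nz: "norm z < 1" using z by simp
    have "norm (\<Sum>n. of_real (real (Suc n) * B n) * z ^ n :: complex) \<le> b (norm z)"
      "norm (\<Sum>n. of_real (real (Suc n) * A n) * z ^ n :: complex) \<le> a (norm z)"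
      unfolding a_def b_def by (intro norm_deriv_pser_le conv nn nz)+
    then show ?thesis
      using ab[of "norm z"] nz norm_triangle_ineq2[of 1 "\<Sum>n. of_real (real (Suc n) * A n) * z ^ n :: complex"]
      unfolding dh[OF nz] dg[OF nz] norm_mult norm_sign by simp
  qed
  have "inj_on (harm_series A B) unit_disc"
  proof (rule inj_onI, rule ccontr)
    fix z w assume z: "z \<in> unit_disc" and w: "w \<in> unit_disc" and ne: "z \<noteq> w"
      and eq: "harm_series A B z = harm_series A B w"
    define r where "r = max (norm z) (norm w)"
    have r: "norm z \<le> r" "norm w \<le> r" "r < 1" "0 \<le> r" using z w by (auto simp: r_def le_max_iff_disj)
    have "z - w = (pser A z - pser A w) - (-1) ^ (u - 1) * cnj (pser B z - pser B w)"
      using eq z w by (simp add: harm_series_def algebra_simps)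
    then have "norm (z - w) \<le> norm (pser A z - pser A w) + norm (pser B z - pser B w)"
      using norm_triangle_ineq4[of "pser A z - pser A w" "(-1) ^ (u - 1) * cnj (pser B z - pser B w)"]
      by (simp only: norm_mult norm_sign complex_mod_cnj mult_1)
    also have "\<dots> \<le> a r * norm (z - w) + b r * norm (z - w)"
      unfolding a_def b_def by (intro add_mono norm_pser_diff_le conv nn r(1-3))
    also have "\<dots> = (a r + b r) * norm (z - w)" by (simp add: distrib_right)
    also have "\<dots> < norm (z - w)" using ab[OF r(4,3)] ne by simp
    finally show False by simp
  qed
  moreover have "deriv (\<lambda>z. z - pser A z) 0 = 1"
    unfolding dh[of 0, simplified] using A0 by (simp add: powser_zero)
  moreover have "harm_series A B 0 = 0" by (simp add: harm_series_def)
  ultimately show ?thesis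
    unfolding SH_def using harmonic_parts_harm_series[OF conv] sense by blast
qed

section \<open>Extreme points of the class\<close>

text \<open>
If \<open>\<xi> n < n + 1\<close>, then the derivative \<open>1 - (n + 1) z^n / \<xi> n\<close> has a zero on the positive radius.
\<close>

lemma P_in_SH_imp_le_xi:
  assumes "\<P> n \<in> SH" "n \<noteq> 0"
  shows "real (Suc n) \<le> \<xi> n"
proof (rule ccontr)
  assume less: "\<not> real (Suc n) \<le> \<xi> n"
  obtain h g where hp: "harmonic_parts (\<P> n) h g"
    and sense: "\<And>z. z \<in> unit_disc \<Longrightarrow> cmod (deriv g z) < cmod (deriv h z)"
    using assms(1) unfolding SH_def by blast
  have hp': "harmonic_parts (\<P> n) (\<lambda>z. z - of_real (1 / \<xi> n) * z ^ Suc n) (\<lambda>_. 0)"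
    using assms(2) by (auto simp: harmonic_parts_def P_fun_def intro!: holomorphic_intros)
  \<comment> \<open>The zero of the derivative.\<close>
  define r where "r = root n (\<xi> n / real (Suc n))"
  have r: "0 \<le> r" "r < 1" "r ^ n = \<xi> n / real (Suc n)"
    using assms(2) xi_pos[of n] less by (auto simp: r_def field_simps)
  let ?z = "complex_of_real r"
  have z: "?z \<in> unit_disc" using r by simp
  have pow: "((\<lambda>z. z ^ Suc n) has_field_derivative of_nat (Suc n) * ?z ^ n) (at ?z)"
    using DERIV_power_Suc[OF DERIV_ident, of n ?z UNIV] by simp
  have "((\<lambda>z. z - of_real (1 / \<xi> n) * z ^ Suc n) has_field_derivative
      1 - of_real (1 / \<xi> n) * (of_nat (Suc n) * ?z ^ n)) (at ?z)"
    by (intro DERIV_diff DERIV_ident DERIV_cmult pow)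
  moreover have "1 - of_real (1 / \<xi> n) * (of_nat (Suc n) * ?z ^ n) = 0"
  proof -
    have "(1 / \<xi> n) * (real (Suc n) * r ^ n) = 1" using r(3) xi_pos[of n] by (simp del: of_nat_Suc)
    from arg_cong[OF this, of complex_of_real] show ?thesis by simp
  qed
  ultimately have "((\<lambda>z. z - of_real (1 / \<xi> n) * z ^ Suc n) has_field_derivative 0) (at ?z)" by simp
  then have "(h has_field_derivative 0) (at ?z)"
    by (rule has_field_derivative_transform_within_open[where S = unit_disc])
       (use z harmonic_parts_unique[OF hp hp'] in auto)
  then have "deriv h ?z = 0" by (rule DERIV_imp_deriv)
  with sense[OF z] show False by simp
qed

text \<open>
If \<open>\<eta> n < n + 1\<close>, then \<open>\<bar>g'\<bar> = (n + 1) \<bar>z\<bar>^n / \<eta> n\<close> reaches the value \<open>1 = h'\<close> inside the disc.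
\<close>

lemma Q_in_SH_imp_le_eta:
  assumes "\<Q> n \<in> SH" "n \<noteq> 0"
  shows "real (Suc n) \<le> \<eta> n"
proof (rule ccontr)
  assume less: "\<not> real (Suc n) \<le> \<eta> n"
  obtain h g where hp: "harmonic_parts (\<Q> n) h g"
    and sense: "\<And>z. z \<in> unit_disc \<Longrightarrow> cmod (deriv g z) < cmod (deriv h z)"
    using assms(1) unfolding SH_def by blast
  have hp': "harmonic_parts (\<Q> n) (\<lambda>z. z) (\<lambda>z. (-1) ^ (u - 1) * (of_real (1 / \<eta> n) * z ^ Suc n))"
    by (auto simp: harmonic_parts_def Q_fun_def intro!: holomorphic_intros)
  \<comment> \<open>The radius on which \<open>\<bar>g'\<bar> = 1\<close>.\<close>
  define r where "r = root n (\<eta> n / real (Suc n))"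
  have r: "0 \<le> r" "r < 1" "r ^ n = \<eta> n / real (Suc n)"
    using assms(2) eta_pos[of n] less by (auto simp: r_def field_simps)
  let ?z = "complex_of_real r"
  have z: "?z \<in> unit_disc" using r by simp
  have pow: "((\<lambda>z. z ^ Suc n) has_field_derivative of_nat (Suc n) * ?z ^ n) (at ?z)"
    using DERIV_power_Suc[OF DERIV_ident, of n ?z UNIV] by simp
  have "((\<lambda>z. (-1) ^ (u - 1) * (of_real (1 / \<eta> n) * z ^ Suc n)) has_field_derivative
      (-1) ^ (u - 1) * (of_real (1 / \<eta> n) * (of_nat (Suc n) * ?z ^ n))) (at ?z)"
    by (intro DERIV_cmult pow)
  moreover have "of_real (1 / \<eta> n) * (of_nat (Suc n) * ?z ^ n) = 1"
  proof -
    have "(1 / \<eta> n) * (real (Suc n) * r ^ n) = 1" using r(3) eta_pos[of n] by (simp del: of_nat_Suc)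
    from arg_cong[OF this, of complex_of_real] show ?thesis by simp
  qed
  ultimately have "((\<lambda>z. (-1) ^ (u - 1) * (of_real (1 / \<eta> n) * z ^ Suc n)) has_field_derivative
      (-1) ^ (u - 1)) (at ?z)" by simp
  then have "(g has_field_derivative (-1) ^ (u - 1)) (at ?z)"
    by (rule has_field_derivative_transform_within_open[where S = unit_disc])
       (use z harmonic_parts_unique[OF hp hp'] in auto)
  then have "deriv g ?z = (-1) ^ (u - 1)" by (rule DERIV_imp_deriv)
  moreover have "((\<lambda>z. z) has_field_derivative 1) (at ?z)" by (rule DERIV_ident)
  then have "(h has_field_derivative 1) (at ?z)"
    by (rule has_field_derivative_transform_within_open[where S = unit_disc])
       (use z harmonic_parts_unique[OF hp hp'] in auto)
  then have "deriv h ?z = 1" by (rule DERIV_imp_deriv)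
  ultimately show False using sense[OF z] by simp
qed

text \<open>
For \<open>lam \<ge> 1\<close> already \<open>1 + n lam \<ge> n + 1\<close>, and \<open>u \<ge> 1\<close>; the other alternative gives the same growth
through the necessary conditions for single \<open>P\<close>s and \<open>Q\<close>s. At \<open>n = 0\<close> the bound \<open>\<eta> \<ge> 1\<close> suffices,
as \<open>A 0 = 0\<close>.
\<close>

lemma linear_growth_of_weights:
  assumes "1 \<le> lam \<or> (\<forall>n\<ge>2. P_fun k u v \<alpha> lam n \<in> SH \<and> Q_fun k u v \<alpha> lam n \<in> SH)"
    and adm: "admissible A B"
  shows "real (Suc n) * (A n + B n) \<le> \<xi> n * A n + \<eta> n * B n"
proof -
  have nn: "0 \<le> A n" "0 \<le> B n" and A0: "A 0 = 0" using adm by (auto simp: admissible_def)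
  have "n = 0 \<or> (real (Suc n) \<le> \<xi> n \<and> real (Suc n) \<le> \<eta> n)"
    using assms(1)
  proof
    assume lam1: "1 \<le> lam"
    have "real (Suc n) \<le> 1 + real n * lam"
      using mult_left_mono[OF lam1, of "real n"] by simp
    also have "\<dots> \<le> mult_u n"
      using power_increasing[OF u1, of "1 + real n * lam"] lam by simp
    finally show ?thesis using mult_u_le_xi[of n] mult_u_le_eta[of n] by linarith
  next
    assume "\<forall>n\<ge>2. P_fun k u v \<alpha> lam n \<in> SH \<and> Q_fun k u v \<alpha> lam n \<in> SH"
    then show ?thesis
      using P_in_SH_imp_le_xi[of n] Q_in_SH_imp_le_eta[of n] by (cases n) auto
  qed
  then show ?thesis
  proof
    assume "n = 0"
    then show ?thesis using A0 nn mult_right_mono[OF eta_ge_1[of 0] nn(2)] by simp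
  next
    assume "real (Suc n) \<le> \<xi> n \<and> real (Suc n) \<le> \<eta> n"
    then show ?thesis
      unfolding distrib_left using nn by (intro add_mono mult_right_mono) auto
  qed
qed

lemma admissible_B0_le_1:
  assumes "admissible A B" shows "B 0 \<le> 1"
proof -
  obtain x y where w: "weights x y" and B: "B = coefB y" using assms by (rule admissible_imp_weights)
  have "y 0 \<le> suminf y"
    using weights_summable[OF w] w sum_le_suminf[of y "{0}"] by (auto simp: weights_def)
  also have "\<dots> \<le> 1"
    using weights_summable[OF w] w suminf_nonneg[of x] by (auto simp: weights_def)
  finally show ?thesis
    using eta_ge_1[of 0] eta_pos[of 0] unfolding B coefB_def by (simp add: divide_le_eq)
qed

lemma admissible_mix:
  assumes "admissible A B" "admissible A' B'" "0 \<le> t" "t \<le> 1"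
  shows "admissible (\<lambda>n. (1 - t) * A n + t * A' n) (\<lambda>n. (1 - t) * B n + t * B' n)"
proof -
  let ?W = "\<lambda>A B n. \<xi> n * A n + \<eta> n * B n"
  have s: "?W A B sums suminf (?W A B)" "?W A' B' sums suminf (?W A' B')"
    using assms by (auto simp: admissible_def summable_sums)
  have le: "suminf (?W A B) \<le> 1" "suminf (?W A' B') \<le> 1"
    using assms by (auto simp: admissible_def)
  have "(\<lambda>n. (1 - t) * ?W A B n + t * ?W A' B' n) sums ((1 - t) * suminf (?W A B) + t * suminf (?W A' B'))"
    by (intro sums_add sums_mult s)
  moreover have "(1 - t) * suminf (?W A B) + t * suminf (?W A' B') \<le> 1"
    using convex_bound_le[OF le, of "1 - t" t] assms by simp
  moreover have "(\<lambda>n. (1 - t) * ?W A B n + t * ?W A' B' n) =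
      ?W (\<lambda>n. (1 - t) * A n + t * A' n) (\<lambda>n. (1 - t) * B n + t * B' n)"
    by (simp add: fun_eq_iff algebra_simps)
  ultimately show ?thesis using assms by (auto simp: admissible_def sums_iff)
qed

text \<open>
Suppose \<open>f = (1 - t) p + t q\<close> with distinct \<open>p\<close>, \<open>q\<close> in the simplex. One of them may be a
non-univalent \<open>Q\<^sub>1\<close>, so \<open>p\<close> and \<open>q\<close> are replaced by their midpoints with \<open>f\<close>: the coefficient \<open>B 0\<close>
of \<open>f\<close> is less than 1 and those of \<open>p\<close> and \<open>q\<close> are at most 1, so the midpoints have coefficient less
than 1 and are univalent.
\<close>

lemma extreme_points_UTH_subset:
  assumes C: "1 \<le> lam \<or> (\<forall>n\<ge>2. P_fun k u v \<alpha> lam n \<in> SH \<and> Q_fun k u v \<alpha> lam n \<in> SH)"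
  shows "extreme_points (UTH k u v \<alpha> lam) \<subseteq> extreme_points (PQ_series k u v \<alpha> lam)"
proof
  fix f assume f: "f \<in> extreme_points (UTH k u v \<alpha> lam)"
  then have fm: "f \<in> SH" "f \<in> PQ_series k u v \<alpha> lam" by (auto simp: extreme_points_def UTH_eq)
  then obtain A B where AB: "admissible A B" "f = harm_series A B"
    unfolding PQ_series_eq_admissible by blast
  have B0: "B 0 < 1"
    using SH_harm_series_coeff_less_1[OF admissible_disc_conv[OF AB(1)]] AB fm(1) by (auto simp: admissible_def)
  have mid: "(\<lambda>z\<in>unit_disc. of_real (1 - 1/2) * f z + of_real (1/2) * p z) \<in> UTH k u v \<alpha> lam"
    if "p \<in> PQ_series k u v \<alpha> lam" for p
  proof -
    obtain A' B' where AB': "admissible A' B'" "p = harm_series A' B'"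
      using \<open>p \<in> _\<close> unfolding PQ_series_eq_admissible by blast
    define A2 where "A2 = (\<lambda>n. (1 - 1/2) * A n + (1/2) * A' n)"
    define B2 where "B2 = (\<lambda>n. (1 - 1/2) * B n + (1/2) * B' n)"
    have adm: "admissible A2 B2"
      unfolding A2_def B2_def by (rule admissible_mix[OF AB(1) AB'(1)]) auto
    have "B2 0 < 1" using B0 admissible_B0_le_1[OF AB'(1)] by (simp add: B2_def)
    from harm_series_SH[OF adm this linear_growth_of_weights[OF C adm]]
    have "harm_series A2 B2 \<in> UTH k u v \<alpha> lam"
      using adm unfolding UTH_eq PQ_series_eq_admissible by blast
    then show ?thesis
      using harm_series_mix[OF admissible_disc_conv[OF AB(1)] admissible_disc_conv[OF AB'(1)], of "1/2"]
      unfolding A2_def B2_def AB(2) AB'(2) by simp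
  qed
  show "f \<in> extreme_points (PQ_series k u v \<alpha> lam)"
    unfolding extreme_points_def
  proof (intro CollectI conjI notI fm)
    assume "\<exists>p\<in>PQ_series k u v \<alpha> lam. \<exists>q\<in>PQ_series k u v \<alpha> lam. \<exists>t::real. p \<noteq> q \<and> 0 < t \<and> t < 1 \<and>
     f = (\<lambda>z\<in>unit_disc. of_real (1 - t) * p z + of_real t * q z)"
    then obtain p q t where pq: "p \<in> PQ_series k u v \<alpha> lam" "q \<in> PQ_series k u v \<alpha> lam" "p \<noteq> q"
      and t: "0 < t" "t < (1::real)"
      and eq: "f = (\<lambda>z\<in>unit_disc. of_real (1 - t) * p z + of_real t * q z)" by blast
    define p' where "p' = (\<lambda>z\<in>unit_disc. of_real (1 - 1/2) * f z + of_real (1/2) * p z)"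
    define q' where "q' = (\<lambda>z\<in>unit_disc. of_real (1 - 1/2) * f z + of_real (1/2) * q z)"
    have "p' \<noteq> q'"
    proof
      assume e: "p' = q'"
      have "p = q"
      proof (rule extensionalityI[of _ unit_disc])
        show "p z = q z" if "z \<in> unit_disc" for z
          using fun_cong[OF e, of z] that by (simp add: p'_def q'_def)
      qed (use pq in \<open>auto simp: PQ_series_def\<close>)
      with pq(3) show False by simp
    qed
    moreover have "f = (\<lambda>z\<in>unit_disc. of_real (1 - t) * p' z + of_real t * q' z)"
    proof (rule extensionalityI[of _ unit_disc])
      fix z assume z: "z \<in> unit_disc"
      have fz: "of_real (1 - t) * p z + of_real t * q z = f z"
        using fun_cong[OF eq, of z] z by simp
      have "of_real (1 - t) * p' z + of_real t * q' z =
          (1/2) * f z + (1/2) * (of_real (1 - t) * p z + of_real t * q z)"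
        using z by (simp add: p'_def q'_def field_simps)
      then show "f z = (\<lambda>z\<in>unit_disc. of_real (1 - t) * p' z + of_real t * q' z) z"
        unfolding fz using z by simp
    qed (use fm(2) in \<open>auto simp: PQ_series_def\<close>)
    ultimately show False
      using f mid[OF pq(1)] mid[OF pq(2)] t unfolding extreme_points_def p'_def [symmetric] q'_def [symmetric]
      by blast
  qed
qed

end

theorem theorem2p3:
  fixes lam \<alpha> k :: real and u v :: nat
  assumes "0 \<le> lam" and "0 \<le> \<alpha>" and "\<alpha> < 1" and "0 \<le> k" and "1 \<le> u" and "v < u"
  shows "(\<forall>f h g a b. f \<in> SH \<and> harmonic_parts f h g \<and> neg_coeff_form u h g a b \<longrightarrow>
            (f \<in> UTH k u v \<alpha> lam \<longleftrightarrow> f \<in> PQ_series k u v \<alpha> lam)) \<and>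
         extreme_points (PQ_series k u v \<alpha> lam) = PQ k u v \<alpha> lam \<and>
         PQ k u v \<alpha> lam \<inter> SH \<subseteq> extreme_points (UTH k u v \<alpha> lam) \<and>
         (1 \<le> lam \<or> (\<forall>n\<ge>2. P_fun k u v \<alpha> lam n \<in> SH \<and> Q_fun k u v \<alpha> lam n \<in> SH) \<longrightarrow>
            extreme_points (UTH k u v \<alpha> lam) = PQ k u v \<alpha> lam \<inter> SH)"
proof -
  interpret uniform_class lam \<alpha> k u v by standard (use assms in auto)
  have sub: "PQ k u v \<alpha> lam \<inter> SH \<subseteq> extreme_points (UTH k u v \<alpha> lam)"
    unfolding extreme_points_PQ_series [symmetric] UTH_eq by (auto simp: extreme_points_def)
  moreover have "extreme_points (UTH k u v \<alpha> lam) \<subseteq> SH"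
    by (auto simp: extreme_points_def UTH_eq)
  ultimately show ?thesis
    using extreme_points_UTH_subset extreme_points_PQ_series by (auto simp: UTH_eq)
qed

end
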